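(* Fix an integer $r \ge 2$ and parameters $\theta = (\mu,\sigma,\xi)$ with $\mu\in\mathbb{R}$, $\sigma>0$, $\xi\in\mathbb{R}$. Let $(Y_{i1},\ldots,Y_{ir})$, $i=1,\ldots,n$, be independent and identically distributed random vectors, each following the GEV$_r(\mu,\sigma,\xi)$ distribution. Define $z_{ij} = (Y_{ij}-\mu)/\sigma$ and $$D_{ir}(\theta) = -\log\sigma - (1+\xi z_{ir})^{-1/\xi} + (1+\xi z_{i,r-1})^{-1/\xi} - \Big(\frac{1}{\xi}+1\Big)\log(1+\xi z_{ir})$$ (for $\xi=0$ interpreted as the limit $\xi\to 0$, i.e. $D_{ir} = -\log\sigma - e^{-z_{ir}} + e^{-z_{i,r-1}} - z_{ir}$). Let $\bar D_r = n^{-1}\sum_{i=1}^n D_{ir}$, $S_{D_r}^2 = \sum_{i=1}^n (D_{ir}-\bar D_r)^2/(n-1)$, $\eta_r = -\log\sigma - 1 + (1+\xi)\psi(r)$, where $\psi$ is the digamma function, and $$T_n^{(r)}(\theta) = \sqrt{n}\,(\bar D_r - \eta_r)/S_{D_r}.$$ Then $T_n^{(r)}(\theta)$ converges in distribution to $N(0,1)$ as $n\to\infty$.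
   Context: The GEV$_r(\mu,\sigma,\xi)$ distribution (limiting joint distribution of the $r$ largest order statistics) is the distribution on $\{y_1>y_2>\cdots>y_r\}$ with density $$f_r(y_1,\ldots,y_r\mid\mu,\sigma,\xi) = \sigma^{-r}\exp\Big\{-(1+\xi z_r)^{-1/\xi} - \Big(\frac1\xi+1\Big)\sum_{j=1}^r \log(1+\xi z_j)\Big\},$$ where $z_j=(y_j-\mu)/\sigma$, supported where $1+\xi z_j>0$ for all $j$; for $\xi=0$ the density is the limit as $\xi\to0$, namely $\sigma^{-r}\exp\{-e^{-z_r} - \sum_{j=1}^r z_j\}$. The quantity $D_{ir}$ is the difference $l^{(r)}-l^{(r-1)}$ of the log-densities of the GEV$_r$ and GEV$_{r-1}$ models evaluated at the $r$ and $r-1$ top components of block $i$. *)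

theory Defs
  imports "HOL-Probability.Probability"
begin

text \<open>Observations of a block are functions y :: nat => real, components y 1 > ... > y r
  (indices 1..r), living in the product space PiM {1..r} (%_. lborel).\<close>

definition gev_space :: "nat \<Rightarrow> (nat \<Rightarrow> real) measure" where
  "gev_space r = PiM {1..r} (\<lambda>_. lborel)"

definition gev_r_density :: "nat \<Rightarrow> real \<Rightarrow> real \<Rightarrow> real \<Rightarrow> (nat \<Rightarrow> real) \<Rightarrow> real" where
  "gev_r_density r \<mu> \<sigma> \<xi> y =
     (let z = (\<lambda>j. (y j - \<mu>) / \<sigma>) in
      if (\<forall>j\<in>{1..<r}. y (Suc j) < y j) \<and> (\<forall>j\<in>{1..r}. 0 < 1 + \<xi> * z j) then
        (if \<xi> = 0 then
           \<sigma> powr (- real r) * exp (- exp (- z r) - (\<Sum>j=1..r. z j))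
         else
           \<sigma> powr (- real r) * exp (- ((1 + \<xi> * z r) powr (-1/\<xi>))
                                 - (1/\<xi> + 1) * (\<Sum>j=1..r. ln (1 + \<xi> * z j))))
      else 0)"

definition gev_r_distribution :: "nat \<Rightarrow> real \<Rightarrow> real \<Rightarrow> real \<Rightarrow> (nat \<Rightarrow> real) measure" where
  "gev_r_distribution r \<mu> \<sigma> \<xi> =
     density (gev_space r) (\<lambda>y. ennreal (gev_r_density r \<mu> \<sigma> \<xi> y))"

definition gev_D :: "nat \<Rightarrow> real \<Rightarrow> real \<Rightarrow> real \<Rightarrow> (nat \<Rightarrow> real) \<Rightarrow> real" where
  "gev_D r \<mu> \<sigma> \<xi> y =
     (let z = (\<lambda>j. (y j - \<mu>) / \<sigma>) in
      if \<xi> = 0 then - ln \<sigma> - exp (- z r) + exp (- z (r - 1)) - z r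
      else - ln \<sigma> - (1 + \<xi> * z r) powr (-1/\<xi>) + (1 + \<xi> * z (r - 1)) powr (-1/\<xi>)
           - (1/\<xi> + 1) * ln (1 + \<xi> * z r))"

definition gev_eta :: "nat \<Rightarrow> real \<Rightarrow> real \<Rightarrow> real" where
  "gev_eta r \<sigma> \<xi> = - ln \<sigma> - 1 + (1 + \<xi>) * Digamma (real r)"

definition gev_T :: "nat \<Rightarrow> real \<Rightarrow> real \<Rightarrow> real \<Rightarrow> nat \<Rightarrow> (nat \<Rightarrow> nat \<Rightarrow> real) \<Rightarrow> real" where
  "gev_T r \<mu> \<sigma> \<xi> n Y =
     (let D = (\<lambda>i. gev_D r \<mu> \<sigma> \<xi> (Y i));
          Dbar = (\<Sum>i=1..n. D i) / real n;
          S = sqrt ((\<Sum>i=1..n. (D i - Dbar)^2) / (real n - 1))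
      in sqrt (real n) * (Dbar - gev_eta r \<sigma> \<xi>) / S)"

end

theory Submission
  imports Defs "HOL-Real_Asymp.Real_Asymp"
begin

text \<open>
  Put \<open>w(y) = (1 + \<xi> (y - \<mu>) / \<sigma>) powr (-1/\<xi>)\<close>, a decreasing map of the support onto \<open>(0, \<infinity>)\<close>. The density
  of a block is \<open>exp (- w(y\<^sub>r))\<close> times the product of the \<open>- w'(y\<^sub>j)\<close>, so that \<open>w(y\<^sub>1) < \<dots> < w(y\<^sub>r)\<close> are
  distributed like the first \<open>r\<close> points of a unit Poisson process: \<open>w(y\<^sub>j)\<close> is Erlang distributed with
  shape \<open>j\<close>. Moreover
  \<open>D = - ln \<sigma> - (w(y\<^sub>r) - w(y\<^bsub>r-1\<^esub>)) + (1 + \<xi>) ln (w(y\<^sub>r))\<close>,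
  whose mean is \<open>\<eta>\<^sub>r\<close> because the logarithm of an Erlang variable of shape \<open>r\<close> has mean \<open>\<psi>(r)\<close>. All
  moments of \<open>D\<close> are finite, and \<open>D\<close> has no atoms, hence positive variance. The theorem follows from
  the central limit theorem, the consistency of the sample variance, and Slutsky's lemma.
\<close>

section \<open>The studentized central limit theorem\<close>

text \<open>The variance of \<open>D\<close> is never computed; it only has to be finite and
  positive. Positivity holds for every \<xi> because \<open>D\<close> is affine in
  \<open>w(y_(r-1))\<close> with slope 1: once \<open>w(y_r)\<close> is fixed, at most one value of
  the other variable gives \<open>D = c\<close>, and Fubini turns this into a null event. No change
  of variables in dimension \<open>r\<close> is made either. Apart from the factor
  \<open>exp (- w(y_r))\<close> and the ordering, the density is a product, so components are
  integrated out one at a time, and each one-dimensional substitution \<open>t = w(y)\<close> trades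
  the parameters for Lebesgue measure on the positive half-line. The components above the last two
  contribute the volume \<open>a^(r-2) / (r-2)!\<close> of an ordered simplex, leaving the joint
  density \<open>a^(r-2) / (r-2)! * exp (- t)\<close> on \<open>0 < a < t\<close> for the last two
  images. This one formula yields the normalisation of the density, both marginals and the absence
  of atoms. Fourth moments enter through the sample variance: they give the squared deviations a
  finite variance, so that Markov's inequality suffices.\<close>

lemma (in prob_space) indep_vars_reindex:
  assumes "inj f" and ind: "indep_vars N X UNIV"
  shows "indep_vars (\<lambda>i. N (f i)) (\<lambda>i. X (f i)) UNIV"
  unfolding indep_vars_def2
proof (intro conjI ballI)
  let ?F = "\<lambda>i. {X i -` A \<inter> space M |A. A \<in> sets (N i)}"
  show "random_variable (N (f i)) (X (f i))" for i
    using ind by (simp add: indep_vars_def2)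
  have F: "indep_sets ?F UNIV" using ind by (simp add: indep_vars_def2)
  show "indep_sets (\<lambda>i. ?F (f i)) UNIV"
  proof (rule indep_setsI)
    show "?F (f i) \<subseteq> events" for i using F by (auto simp: indep_sets_def)
    fix A J assume J: "J \<noteq> {}" "finite J" and A: "\<forall>j\<in>J. A j \<in> ?F (f j)"
    have inv: "inv f (f j) = j" for j using assms(1) by (rule inv_f_f)
    \<comment> \<open>The event \<open>A j\<close> is attached to the index \<open>f j\<close>;
      injectivity lets \<open>inv f\<close> recover \<open>j\<close>, so the product rule of the
      original family applies on the image of \<open>J\<close>.\<close>
    have "prob (\<Inter>i\<in>f ` J. A (inv f i)) = (\<Prod>i\<in>f ` J. prob (A (inv f i)))"
      using J A by (intro indep_setsD[OF F]) (auto simp: inv)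
    then show "prob (\<Inter>j\<in>J. A j) = (\<Prod>j\<in>J. prob (A j))"
      using inj_on_subset[OF assms(1), of J] by (simp add: prod.reindex inv)
  qed
qed

text \<open>Slutsky's lemma for quotients. Where \<open>R n\<close> is within \<open>d < 1\<close>
  of 1 it is positive, so \<open>Z n / R n \<le> x\<close> means \<open>Z n \<le> x * R n\<close>,
  and the right side lies within \<open>d * \<bar>x\<bar>\<close> of \<open>x\<close>. Continuity of
  the limiting distribution function absorbs this shift, and the exceptional event has vanishing
  probability.\<close>

lemma (in prob_space) weak_conv_m_divide:
  fixes Z R :: "nat \<Rightarrow> 'a \<Rightarrow> real"
  assumes Z [measurable]: "\<And>n. Z n \<in> borel_measurable M"
    and R [measurable]: "\<And>n. R n \<in> borel_measurable M"
    and conv: "weak_conv_m (\<lambda>n. distr M borel (Z n)) L"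
    and cont: "\<And>x. isCont (cdf L) x"
    and R1: "\<And>d. 0 < d \<Longrightarrow> (\<lambda>n. prob {\<omega>\<in>space M. d \<le> \<bar>R n \<omega> - 1\<bar>}) \<longlonglongrightarrow> 0"
  shows "weak_conv_m (\<lambda>n. distr M borel (\<lambda>\<omega>. Z n \<omega> / R n \<omega>)) L"
  unfolding weak_conv_m_def weak_conv_def
proof (intro allI impI tendstoI)
  fix x e :: real assume "0 < e"
  have cdf_Z: "cdf (distr M borel (Z n)) y = prob {\<omega>\<in>space M. Z n \<omega> \<le> y}" for n y
    by (auto simp: cdf_def measure_distr intro!: arg_cong[where f=prob])
  have cdf_T: "cdf (distr M borel (\<lambda>\<omega>. Z n \<omega> / R n \<omega>)) y
      = prob {\<omega>\<in>space M. Z n \<omega> / R n \<omega> \<le> y}" for n y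
    by (auto simp: cdf_def measure_distr intro!: arg_cong[where f=prob])
  have Zlim: "(\<lambda>n. prob {\<omega>\<in>space M. Z n \<omega> \<le> y}) \<longlonglongrightarrow> cdf L y" for y
    using conv cont unfolding weak_conv_m_def weak_conv_def cdf_Z by blast
  obtain c where c: "c > 0" "\<And>y. \<bar>y - x\<bar> < c \<Longrightarrow> \<bar>cdf L y - cdf L x\<bar> < e / 3"
    using cont[of x] \<open>0 < e\<close> unfolding continuous_at_eps_delta
    by (metis dist_real_def divide_pos_pos zero_less_numeral)
  \<comment> \<open>The bound \<open>1/2\<close> keeps the denominator positive; the other one makes
    the shift at most \<open>c / 2\<close>, with \<open>\<bar>x\<bar> + 1\<close> in place of
    \<open>\<bar>x\<bar>\<close> to allow \<open>x = 0\<close>.\<close>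
  define d where "d = min (1/2) (c / (2 * (\<bar>x\<bar> + 1)))"
  have d: "0 < d" "d < 1" using c(1) by (auto simp: d_def)
  have "d * \<bar>x\<bar> \<le> d * (\<bar>x\<bar> + 1)" using d by simp
  also have "\<dots> \<le> c / (2 * (\<bar>x\<bar> + 1)) * (\<bar>x\<bar> + 1)"
    by (intro mult_right_mono) (auto simp: d_def)
  also have "\<dots> = c / 2" by (simp add: field_simps)
  also have "\<dots> < c" using c(1) by simp
  finally have dx: "d * \<bar>x\<bar> < c" .
  define u where "u = x + d * \<bar>x\<bar>"
  define l where "l = x - d * \<bar>x\<bar>"
  have ul: "\<bar>cdf L u - cdf L x\<bar> < e/3" "\<bar>cdf L l - cdf L x\<bar> < e/3"
    by (rule c(2); use dx d in \<open>simp add: u_def l_def abs_mult\<close>)+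
  let ?B = "\<lambda>n. {\<omega>\<in>space M. d \<le> \<bar>R n \<omega> - 1\<bar>}"
  have e3: "0 < e / 3" using \<open>0 < e\<close> by simp
  from tendstoD[OF Zlim[of u] e3] tendstoD[OF Zlim[of l] e3] tendstoD[OF R1[OF d(1)] e3]
  show "\<forall>\<^sub>F n in sequentially.
      dist (cdf (distr M borel (\<lambda>\<omega>. Z n \<omega> / R n \<omega>)) x) (cdf L x) < e"
  proof eventually_elim
    case (elim n)
    have *: "\<omega> \<in> ?B n \<or> ((Z n \<omega> / R n \<omega> \<le> x \<longrightarrow> Z n \<omega> \<le> u) \<and> (Z n \<omega> \<le> l \<longrightarrow> Z n \<omega> / R n \<omega> \<le> x))"
      if "\<omega> \<in> space M" for \<omega>
    proof (cases "\<omega> \<in> ?B n")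
      case False
      then have r: "\<bar>R n \<omega> - 1\<bar> < d" using that by auto
      then have "R n \<omega> > 0" using d by auto
      have "\<bar>x * R n \<omega> - x\<bar> = \<bar>x\<bar> * \<bar>R n \<omega> - 1\<bar>"
        by (metis abs_mult mult.right_neutral right_diff_distrib)
      also have "\<dots> \<le> \<bar>x\<bar> * d" using r by (intro mult_left_mono) auto
      finally have "l \<le> x * R n \<omega>" "x * R n \<omega> \<le> u"
        by (auto simp: l_def u_def mult.commute abs_le_iff)
      then show ?thesis using \<open>R n \<omega> > 0\<close> by (auto simp: divide_le_eq)
    qed auto
    have "prob {\<omega>\<in>space M. Z n \<omega> / R n \<omega> \<le> x} \<le> prob ({\<omega>\<in>space M. Z n \<omega> \<le> u} \<union> ?B n)"
      using * by (intro finite_measure_mono) auto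
    also have "\<dots> \<le> prob {\<omega>\<in>space M. Z n \<omega> \<le> u} + prob (?B n)"
      by (intro measure_Un_le) auto
    finally have 1: "prob {\<omega>\<in>space M. Z n \<omega> / R n \<omega> \<le> x}
      \<le> prob {\<omega>\<in>space M. Z n \<omega> \<le> u} + prob (?B n)" .
    have "prob {\<omega>\<in>space M. Z n \<omega> \<le> l} \<le> prob ({\<omega>\<in>space M. Z n \<omega> / R n \<omega> \<le> x} \<union> ?B n)"
      using * by (intro finite_measure_mono) auto
    also have "\<dots> \<le> prob {\<omega>\<in>space M. Z n \<omega> / R n \<omega> \<le> x} + prob (?B n)"
      by (intro measure_Un_le) auto
    finally have 2: "prob {\<omega>\<in>space M. Z n \<omega> \<le> l}
      \<le> prob {\<omega>\<in>space M. Z n \<omega> / R n \<omega> \<le> x} + prob (?B n)" .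
    show ?case
      unfolding cdf_T dist_real_def
      using 1 2 elim ul unfolding dist_real_def by arith
  qed
qed

lemma isCont_cdf_std_normal: "isCont (cdf std_normal_distribution) x"
proof -
  interpret real_distribution std_normal_distribution by (rule real_dist_normal_dist)
  have "emeasure std_normal_distribution {x} = 0"
    by (subst emeasure_density) (auto simp: nn_integral_indicator_singleton')
  then show ?thesis by (simp add: isCont_cdf measure_def)
qed

section \<open>Second moments of independent sums and consistency of the sample variance\<close>

lemma (in prob_space) indep_sum_square:
  fixes V :: "nat \<Rightarrow> 'a \<Rightarrow> real"
  assumes ind: "indep_vars (\<lambda>_. borel) V UNIV"
    and sq: "\<And>i. integrable M (\<lambda>\<omega>. (V i \<omega>)\<^sup>2)"
    and mean: "\<And>i. expectation (V i) = 0"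
    and var: "\<And>i. expectation (\<lambda>\<omega>. (V i \<omega>)\<^sup>2) = v"
  shows "integrable M (\<lambda>\<omega>. (\<Sum>i<n. V i \<omega>)\<^sup>2)"
    and "expectation (\<lambda>\<omega>. (\<Sum>i<n. V i \<omega>)\<^sup>2) = real n * v"
proof -
  have [measurable]: "V i \<in> borel_measurable M" for i
    using ind by (auto simp: indep_vars_def)
  have int: "integrable M (V i)" for i
    by (rule square_integrable_imp_integrable[OF _ sq]) simp
  \<comment> \<open>Independence factors the mixed moments and centring kills them, so only the
    diagonal of the double sum survives.\<close>
  have off: "integrable M (\<lambda>\<omega>. V i \<omega> * V j \<omega>) \<and> expectation (\<lambda>\<omega>. V i \<omega> * V j \<omega>) = (if i = j then v else 0)"
    for i j
  proof (cases "i = j")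
    case True then show ?thesis using sq var by (simp add: power2_eq_square)
  next
    case False
    have "indep_vars (\<lambda>_. borel) V {i, j}" by (rule indep_vars_subset[OF ind]) simp
    from indep_vars_lebesgue_integral[OF _ this] indep_vars_integrable[OF _ this] False
    show ?thesis by (simp add: int mean)
  qed
  have eq: "(\<Sum>i<n. V i \<omega>)\<^sup>2 = (\<Sum>i<n. \<Sum>j<n. V i \<omega> * V j \<omega>)" for \<omega>
    by (simp add: power2_eq_square sum_product)
  show "integrable M (\<lambda>\<omega>. (\<Sum>i<n. V i \<omega>)\<^sup>2)"
    unfolding eq using off by (intro Bochner_Integration.integrable_sum) auto
  show "expectation (\<lambda>\<omega>. (\<Sum>i<n. V i \<omega>)\<^sup>2) = real n * v"
    unfolding eq using off
    by (simp only: Bochner_Integration.integral_sum Bochner_Integration.integrable_sum) simp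
qed

text \<open>This is nonnegativity of the variance of \<open>\<bar>V\<bar>\<close>. It turns the
  second moment of an independent sum into a bound of order \<open>sqrt n\<close> on its first
  absolute moment.\<close>

lemma (in prob_space) expectation_abs_le_sqrt:
  fixes V :: "'a \<Rightarrow> real"
  assumes [measurable]: "V \<in> borel_measurable M" and sq: "integrable M (\<lambda>\<omega>. (V \<omega>)\<^sup>2)"
  shows "expectation (\<lambda>\<omega>. \<bar>V \<omega>\<bar>) \<le> sqrt (expectation (\<lambda>\<omega>. (V \<omega>)\<^sup>2))"
proof -
  have "integrable M V" by (rule square_integrable_imp_integrable[OF _ sq]) simp
  then have "0 \<le> expectation (\<lambda>\<omega>. \<bar>V \<omega>\<bar>\<^sup>2) - (expectation (\<lambda>\<omega>. \<bar>V \<omega>\<bar>))\<^sup>2"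
    using variance_positive[of "\<lambda>\<omega>. \<bar>V \<omega>\<bar>"] by (subst (asm) variance_eq) (auto simp: sq)
  then show ?thesis by (intro real_le_rsqrt) simp
qed

text \<open>The centre \<open>m\<close> is free. Taking it to be the true mean replaces the
  dependent deviations from the sample mean by sums of independent centred variables.\<close>

lemma sum_square_deviation:
  fixes f :: "nat \<Rightarrow> real"
  assumes "0 < n"
  shows "(\<Sum>i<n. (f i - (\<Sum>i<n. f i) / n)\<^sup>2) = (\<Sum>i<n. (f i - m)\<^sup>2) - (\<Sum>i<n. f i - m)\<^sup>2 / n"
proof -
  define B where "B = (\<Sum>i<n. f i - m)"
  have a: "(\<Sum>i<n. f i) / n = m + B / n"
    using assms by (simp add: B_def sum_subtractf field_simps)
  have "(\<Sum>i<n. (f i - (\<Sum>i<n. f i) / n)\<^sup>2) = (\<Sum>i<n. (f i - m)\<^sup>2 - 2 * (B / n) * (f i - m) + (B / n)\<^sup>2)"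
  proof (intro sum.cong refl)
    have "(f i - (m + c))\<^sup>2 = (f i - m)\<^sup>2 - 2 * c * (f i - m) + c\<^sup>2" for c i
      by (simp add: power2_eq_square algebra_simps)
    then show "(f i - (\<Sum>i<n. f i) / n)\<^sup>2 = (f i - m)\<^sup>2 - 2 * (B / n) * (f i - m) + (B / n)\<^sup>2" for i
      unfolding a .
  qed
  also have "\<dots> = (\<Sum>i<n. (f i - m)\<^sup>2) - 2 * (B / n) * B + n * (B / n)\<^sup>2"
    by (simp only: sum.distrib sum_subtractf flip: sum_distrib_left) (simp add: B_def sum_subtractf)
  also have "\<dots> = (\<Sum>i<n. (f i - m)\<^sup>2) - B\<^sup>2 / n"
    using assms by (simp add: field_simps power2_eq_square)
  finally show ?thesis by (simp add: B_def)
qed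

text \<open>Fourth moments give the centred squares \<open>W\<close> a finite variance, so their sum
  has mean absolute value of order \<open>sqrt n\<close>. After division by \<open>n - 1\<close>,
  Markov's inequality yields a bound of order \<open>1 / sqrt n\<close>.\<close>

lemma (in prob_space) sample_variance_consistent:
  fixes X :: "nat \<Rightarrow> 'a \<Rightarrow> real"
  assumes ind: "indep_vars (\<lambda>_. borel) X UNIV"
    and distrib: "\<And>i. distr M borel (X i) = N"
    and fourth: "\<And>i. integrable M (\<lambda>\<omega>. (X i \<omega>) ^ 4)"
    and mean: "\<And>i. expectation (X i) = m"
    and var: "\<And>i. variance (X i) = v"
    and "0 < e"
  shows "(\<lambda>n. prob {\<omega>\<in>space M. e \<le>
      \<bar>(\<Sum>i<n. (X i \<omega> - (\<Sum>i<n. X i \<omega>) / n)\<^sup>2) / (real n - 1) - v\<bar>}) \<longlonglongrightarrow> 0"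
proof -
  have [measurable]: "X i \<in> borel_measurable M" for i
    using ind by (auto simp: indep_vars_def)
  have sq: "integrable M (\<lambda>\<omega>. (X i \<omega>)\<^sup>2)" for i
    by (rule square_integrable_imp_integrable) (use fourth in \<open>auto simp flip: power_mult\<close>)
  have int: "integrable M (X i)" for i
    by (rule square_integrable_imp_integrable[OF _ sq]) simp
  define U where "U i \<omega> = X i \<omega> - m" for i \<omega>
  define W where "W i \<omega> = (U i \<omega>)\<^sup>2 - v" for i \<omega>
  have [measurable]: "U i \<in> borel_measurable M" "W i \<in> borel_measurable M" for i
    by (auto simp: U_def[abs_def] W_def[abs_def])
  have "indep_vars (\<lambda>_. borel) U UNIV" "indep_vars (\<lambda>_. borel) W UNIV"
    unfolding U_def[abs_def] W_def[abs_def]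
    by (rule indep_vars_compose2[OF ind]; simp)+
  note indUW = this
  have U2: "integrable M (\<lambda>\<omega>. (U i \<omega>)\<^sup>2)" for i
    using sq int by (simp add: U_def power2_diff)
  have U1: "expectation (U i) = 0" for i
    by (simp add: U_def[abs_def] int mean prob_space)
  have EU2: "expectation (\<lambda>\<omega>. (U i \<omega>)\<^sup>2) = v" for i
    using var[of i] mean[of i] by (simp add: U_def[abs_def])
  have W2: "integrable M (\<lambda>\<omega>. (W i \<omega>)\<^sup>2)" for i
  proof (rule Bochner_Integration.integrable_bound)
    \<comment> \<open>Two rounds of \<open>(a - b)^2 \<le> 2 * a^2 + 2 * b^2\<close>: the fourth
      power of \<open>X - m\<close> is at most \<open>8 * X^4 + 8 * m^4\<close>, and the outer round
      doubles this and adds \<open>2 * v^2\<close>.\<close>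
    show "integrable M (\<lambda>\<omega>. 16 * (X i \<omega>) ^ 4 + (16 * m ^ 4 + 2 * v\<^sup>2))"
      using fourth by (intro Bochner_Integration.integrable_add integrable_mult_right) auto
    have p2: "(a - b)\<^sup>2 \<le> 2 * a\<^sup>2 + 2 * b\<^sup>2" for a b :: real
      using zero_le_power2[of "a + b"] by (simp add: power2_eq_square algebra_simps)
    show "AE \<omega> in M. norm ((W i \<omega>)\<^sup>2) \<le> norm (16 * (X i \<omega>) ^ 4 + (16 * m ^ 4 + 2 * v\<^sup>2))"
    proof (intro AE_I2)
      fix \<omega>
      have "(W i \<omega>)\<^sup>2 \<le> 2 * ((U i \<omega>)\<^sup>2)\<^sup>2 + 2 * v\<^sup>2" unfolding W_def by (rule p2)
      also have "((U i \<omega>)\<^sup>2)\<^sup>2 \<le> (2 * (X i \<omega>)\<^sup>2 + 2 * m\<^sup>2)\<^sup>2"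
        unfolding U_def by (intro power_mono p2) auto
      also have "\<dots> \<le> 2 * (2 * (X i \<omega>)\<^sup>2)\<^sup>2 + 2 * (2 * m\<^sup>2)\<^sup>2"
        using p2[of "2 * (X i \<omega>)\<^sup>2" "- (2 * m\<^sup>2)"] by simp
      also have "\<dots> = 8 * X i \<omega> ^ 4 + 8 * m ^ 4" by (simp add: power_mult_distrib)
      finally have "(W i \<omega>)\<^sup>2 \<le> 16 * X i \<omega> ^ 4 + 16 * m ^ 4 + 2 * v\<^sup>2" by simp
      then show "norm ((W i \<omega>)\<^sup>2) \<le> norm (16 * (X i \<omega>) ^ 4 + (16 * m ^ 4 + 2 * v\<^sup>2))"
        by simp
    qed
  qed simp
  have W1: "expectation (W i) = 0" for i
    by (simp add: W_def[abs_def] U2 EU2 prob_space)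
  have EW2: "expectation (\<lambda>\<omega>. (W i \<omega>)\<^sup>2) = expectation (\<lambda>\<omega>. (W 0 \<omega>)\<^sup>2)" for i
  proof -
    have "expectation (\<lambda>\<omega>. (W i \<omega>)\<^sup>2) = (\<integral>x. ((x - m)\<^sup>2 - v)\<^sup>2 \<partial>N)" for i
      unfolding W_def U_def distrib[of i, symmetric] by (subst integral_distr) auto
    then show ?thesis by metis
  qed
  define q where "q = expectation (\<lambda>\<omega>. (W 0 \<omega>)\<^sup>2)"
  have q0: "0 \<le> q" and v0: "0 \<le> v"
    using EU2[of 0] by (auto simp: q_def simp flip: EU2[of 0])
  note SU = indep_sum_square[OF indUW(1) U2 U1 EU2]
  note SW = indep_sum_square[OF indUW(2) W2 W1 EW2, folded q_def]
  define S2 where "S2 n \<omega> = (\<Sum>i<n. (X i \<omega> - (\<Sum>i<n. X i \<omega>) / n)\<^sup>2) / (real n - 1)" for n \<omega>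
  have bound: "prob {\<omega>\<in>space M. e \<le> \<bar>S2 n \<omega> - v\<bar>} \<le> ((sqrt (n * q) + 2 * v) / (real n - 1)) / e"
    if n: "n \<ge> 2" for n
  proof -
    \<comment> \<open>Since the squares of \<open>U\<close> sum to the sum of \<open>W\<close> plus
      \<open>n * v\<close>, and \<open>n * v - (n - 1) * v = v\<close>, the numerator of
      \<open>S2 - v\<close> consists of three terms; \<open>G\<close> bounds them by absolute
      values. The last term has mean \<open>v\<close>, whence \<open>2 * v\<close> in the
      bound.\<close>
    define G where "G \<omega> = (\<bar>\<Sum>i<n. W i \<omega>\<bar> + v + (\<Sum>i<n. U i \<omega>)\<^sup>2 / n) / (real n - 1)" for \<omega>
    have iW: "integrable M (\<lambda>\<omega>. \<bar>\<Sum>i<n. W i \<omega>\<bar>)"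
      by (intro integrable_abs square_integrable_imp_integrable[OF _ SW(1)]) simp
    have iG: "integrable M G"
      unfolding G_def[abs_def] using iW SU by auto
    have "expectation G = (expectation (\<lambda>\<omega>. \<bar>\<Sum>i<n. W i \<omega>\<bar>) + v + v) / (real n - 1)"
      unfolding G_def[abs_def] using iW SU n by (simp add: prob_space)
    also have "expectation (\<lambda>\<omega>. \<bar>\<Sum>i<n. W i \<omega>\<bar>) \<le> sqrt (n * q)"
      using expectation_abs_le_sqrt[of "\<lambda>\<omega>. \<Sum>i<n. W i \<omega>"] SW by simp
    finally have EG: "expectation G \<le> (sqrt (n * q) + 2 * v) / (real n - 1)"
      using n by (simp add: divide_right_mono add.commute)
    have le: "\<bar>S2 n \<omega> - v\<bar> \<le> G \<omega>" for \<omega>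
    proof -
      have "S2 n \<omega> - v = ((\<Sum>i<n. (U i \<omega>)\<^sup>2) - (\<Sum>i<n. U i \<omega>)\<^sup>2 / n) / (real n - 1) - v"
        using n sum_square_deviation[of n "\<lambda>i. X i \<omega>" m] by (simp add: S2_def U_def)
      also have "(\<Sum>i<n. (U i \<omega>)\<^sup>2) = (\<Sum>i<n. W i \<omega>) + n * v"
        by (simp add: W_def sum_subtractf)
      also have "((\<Sum>i<n. W i \<omega>) + n * v - (\<Sum>i<n. U i \<omega>)\<^sup>2 / n) / (real n - 1) - v
        = ((\<Sum>i<n. W i \<omega>) + v - (\<Sum>i<n. U i \<omega>)\<^sup>2 / n) / (real n - 1)"
        using n by (simp add: divide_simps) (simp add: algebra_simps)
      also have "\<bar>\<dots>\<bar> \<le> G \<omega>"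
      proof -
        have "\<bar>a + v - c\<bar> \<le> \<bar>a\<bar> + v + c" if "0 \<le> c" for a c :: real
          using that v0 by arith
        then show ?thesis
          unfolding G_def abs_divide using n by (simp add: divide_right_mono)
      qed
      finally show ?thesis .
    qed
    have "prob {\<omega>\<in>space M. e \<le> \<bar>S2 n \<omega> - v\<bar>} \<le> prob {\<omega>\<in>space M. e \<le> G \<omega>}"
      using iG by (intro finite_measure_mono) (auto intro: order_trans[OF _ le])
    also have "\<dots> \<le> expectation G / e"
      using iG \<open>0 < e\<close> order_trans[OF abs_ge_zero le]
      by (intro integral_Markov_inequality_measure[where A="{}"]) auto
    also have "\<dots> \<le> ((sqrt (n * q) + 2 * v) / (real n - 1)) / e"
      using EG \<open>0 < e\<close> by (intro divide_right_mono) auto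
    finally show ?thesis .
  qed
  have "(\<lambda>n. (sqrt (real n) / (real n - 1) * sqrt q + 2 * v / (real n - 1)) / e) \<longlonglongrightarrow> (0 * sqrt q + 0) / e"
  proof (intro tendsto_intros)
    show "(\<lambda>n. sqrt (real n) / (real n - 1)) \<longlonglongrightarrow> 0" by real_asymp
    show "(\<lambda>n. 2 * v / (real n - 1)) \<longlonglongrightarrow> 0" by real_asymp
  qed (use \<open>0 < e\<close> in auto)
  then have lim: "(\<lambda>n. ((sqrt (n * q) + 2 * v) / (real n - 1)) / e) \<longlonglongrightarrow> 0"
    by (simp add: real_sqrt_mult add_divide_distrib)
  show ?thesis
    unfolding S2_def[symmetric]
  proof (rule tendsto_sandwich[OF _ _ tendsto_const lim])
    show "\<forall>\<^sub>F n in sequentially. prob {\<omega>\<in>space M. e \<le> \<bar>S2 n \<omega> - v\<bar>}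
        \<le> ((sqrt (n * q) + 2 * v) / (real n - 1)) / e"
      by (rule eventually_sequentiallyI[of 2]) (rule bound)
  qed simp
qed

text \<open>The statistic is \<open>Z / R\<close>, where \<open>Z\<close> is normalised by the true
  variance and \<open>R = S / sqrt v\<close>. The first converges by the central limit theorem, the
  second tends to 1 in probability.\<close>

theorem (in prob_space) studentized_central_limit_theorem:
  fixes X :: "nat \<Rightarrow> 'a \<Rightarrow> real"
  assumes ind: "indep_vars (\<lambda>_. borel) X UNIV"
    and distrib: "\<And>i. distr M borel (X i) = N"
    and fourth: "\<And>i. integrable M (\<lambda>\<omega>. (X i \<omega>) ^ 4)"
    and mean: "\<And>i. expectation (X i) = m"
    and var: "\<And>i. variance (X i) = v" and "0 < v"
  shows "weak_conv_m (\<lambda>n. distr M borel (\<lambda>\<omega>. sqrt n * ((\<Sum>i<n. X i \<omega>) / n - m) /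
      sqrt ((\<Sum>i<n. (X i \<omega> - (\<Sum>i<n. X i \<omega>) / n)\<^sup>2) / (real n - 1)))) std_normal_distribution"
proof -
  have [measurable]: "X i \<in> borel_measurable M" for i
    using ind by (auto simp: indep_vars_def)
  have sq: "integrable M (\<lambda>\<omega>. (X i \<omega>)\<^sup>2)" for i
    by (rule square_integrable_imp_integrable) (use fourth in \<open>auto simp flip: power_mult\<close>)
  have int: "integrable M (X i)" for i
    by (rule square_integrable_imp_integrable[OF _ sq]) simp
  define S where "S n \<omega> = sqrt ((\<Sum>i<n. (X i \<omega> - (\<Sum>i<n. X i \<omega>) / n)\<^sup>2) / (real n - 1))" for n \<omega>
  define Z where "Z n \<omega> = (\<Sum>i<n. X i \<omega> - m) / sqrt (n * (sqrt v)\<^sup>2)" for n \<omega>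
  define R where "R n \<omega> = S n \<omega> / sqrt v" for n \<omega>
  have [measurable]: "S n \<in> borel_measurable M" for n by (simp add: S_def[abs_def])
  have conv: "weak_conv_m (\<lambda>n. distr M borel (Z n)) std_normal_distribution"
    unfolding Z_def[abs_def]
  proof (rule central_limit_theorem_zero_mean)
    show "indep_vars (\<lambda>_. borel) (\<lambda>i \<omega>. X i \<omega> - m) UNIV"
      by (rule indep_vars_compose2[OF ind]) simp
    show "expectation (\<lambda>\<omega>. X n \<omega> - m) = 0" for n by (simp add: int mean prob_space)
    then show "variance (\<lambda>\<omega>. X n \<omega> - m) = (sqrt v)\<^sup>2" for n
      using var[of n] mean[of n] \<open>0 < v\<close> by simp
    show "0 < sqrt v" using \<open>0 < v\<close> by simp
    show "integrable M (\<lambda>\<omega>. (X n \<omega> - m)\<^sup>2)" for n using sq int by (simp add: power2_diff)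
    show "distr M borel (\<lambda>\<omega>. X n \<omega> - m) = distr N borel (\<lambda>x. x - m)" for n
      unfolding distrib[of n, symmetric] by (subst distr_distr) (auto simp: comp_def)
  qed
  have "weak_conv_m (\<lambda>n. distr M borel (\<lambda>\<omega>. Z n \<omega> / R n \<omega>)) std_normal_distribution"
  proof (rule weak_conv_m_divide[OF _ _ conv isCont_cdf_std_normal])
    show "Z n \<in> borel_measurable M" "R n \<in> borel_measurable M" for n
      by (auto simp: Z_def[abs_def] R_def[abs_def])
    fix d :: real assume "0 < d"
    \<comment> \<open>For \<open>n = 0\<close> the denominator is -1 but the sum is empty; for
      \<open>n = 1\<close> division by zero gives 0.\<close>
    have 0: "0 \<le> (\<Sum>i<n. (X i \<omega> - (\<Sum>i<n. X i \<omega>) / n)\<^sup>2) / (real n - 1)" for n \<omega>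
      by (cases "n = 0") (auto intro!: divide_nonneg_nonneg sum_nonneg)
    \<comment> \<open>The factor \<open>R + 1\<close> is at least 1, so
      \<open>\<bar>R - 1\<bar> \<le> \<bar>R^2 - 1\<bar>\<close>. This removes the square root and
      reduces the claim to consistency of \<open>S^2\<close>.\<close>
    have le: "\<bar>R n \<omega> - 1\<bar> \<le> \<bar>(S n \<omega>)\<^sup>2 - v\<bar> / v" for n \<omega>
    proof -
      have "0 \<le> S n \<omega>" using 0 by (simp add: S_def)
      then have "0 \<le> R n \<omega>" using \<open>0 < v\<close> by (simp add: R_def)
      then have "\<bar>R n \<omega> - 1\<bar> * 1 \<le> \<bar>R n \<omega> - 1\<bar> * (R n \<omega> + 1)"
        by (intro mult_left_mono) auto
      also have "\<dots> = \<bar>(R n \<omega> - 1) * (R n \<omega> + 1)\<bar>"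
        using \<open>0 \<le> R n \<omega>\<close> by (simp add: abs_mult)
      also have "(R n \<omega> - 1) * (R n \<omega> + 1) = ((S n \<omega>)\<^sup>2 - v) / v"
        using \<open>0 < v\<close> by (simp add: R_def power2_eq_square field_simps)
      finally show ?thesis using \<open>0 < v\<close> by simp
    qed
    have S2: "(S n \<omega>)\<^sup>2 = (\<Sum>i<n. (X i \<omega> - (\<Sum>i<n. X i \<omega>) / n)\<^sup>2) / (real n - 1)" for n \<omega>
      using 0 by (simp add: S_def)
    have "0 < d * v" using \<open>0 < d\<close> \<open>0 < v\<close> by simp
    note lim = sample_variance_consistent[OF ind distrib fourth mean var this, folded S2]
    show "(\<lambda>n. prob {\<omega>\<in>space M. d \<le> \<bar>R n \<omega> - 1\<bar>}) \<longlonglongrightarrow> 0"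
    proof (rule tendsto_sandwich[OF _ _ tendsto_const lim])
      show "\<forall>\<^sub>F n in sequentially. prob {\<omega>\<in>space M. d \<le> \<bar>R n \<omega> - 1\<bar>}
          \<le> prob {\<omega>\<in>space M. d * v \<le> \<bar>(S n \<omega>)\<^sup>2 - v\<bar>}"
      proof (intro always_eventually allI finite_measure_mono)
        show "{\<omega>\<in>space M. d \<le> \<bar>R n \<omega> - 1\<bar>} \<subseteq> {\<omega>\<in>space M. d * v \<le> \<bar>(S n \<omega>)\<^sup>2 - v\<bar>}" for n
          using order_trans[OF _ le, of d n] \<open>0 < v\<close> by (auto simp: pos_le_divide_eq)
      qed simp
    qed simp
  qed
  moreover have "Z n \<omega> / R n \<omega> = sqrt n * ((\<Sum>i<n. X i \<omega>) / n - m) / S n \<omega>" for n \<omega>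
  proof (cases "n = 0")
    case False
    have "Z n \<omega> / R n \<omega> = (\<Sum>i<n. X i \<omega> - m) / sqrt n / S n \<omega>"
      using \<open>0 < v\<close> by (simp add: Z_def R_def real_sqrt_mult)
    also have "(\<Sum>i<n. X i \<omega> - m) / sqrt n = sqrt n * ((\<Sum>i<n. X i \<omega>) / n - m)"
      using False by (simp add: sum_subtractf real_divide_square_eq field_simps)
    finally show ?thesis .
  qed (simp add: Z_def)
  ultimately show ?thesis by (simp add: S_def)
qed

section \<open>Logarithmic moments of the Erlang distribution\<close>

text \<open>The index is one less than the shape: \<open>erlang1 k\<close> has shape
  \<open>k + 1\<close> and rate 1.\<close>

abbreviation erlang1 :: "nat \<Rightarrow> real measure" where
  "erlang1 k \<equiv> density lborel (\<lambda>x. ennreal (erlang_density k 1 x))"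

lemma AE_erlang1_pos: "AE x in erlang1 k. 0 < x"
  using AE_lborel_singleton[of 0]
  by (subst AE_density) (auto simp: erlang_density_def split: if_splits)

text \<open>Up to the factor \<open>1 / fact k\<close> the integrand is that of
  \<open>Gamma (Suc k + s)\<close>. Negative exponents are included because they control the
  logarithm near 0, and exponents tending to 0 from both sides produce its mean.\<close>

lemma
  assumes "- real (Suc k) < s"
  shows integrable_erlang1_powr: "integrable (erlang1 k) (\<lambda>x. x powr s)"
    and integral_erlang1_powr: "(\<integral>x. x powr s \<partial>erlang1 k) = Gamma (real (Suc k) + s) / fact k"
proof -
  have "(\<integral>\<^sup>+x. ennreal (x powr s) \<partial>erlang1 k)
      = (\<integral>\<^sup>+x. ennreal (erlang_density k 1 x) * ennreal (x powr s) \<partial>lborel)"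
    by (rule nn_integral_density) auto
  also have "\<dots> = (\<integral>\<^sup>+x. ennreal (1 / fact k) *
      ennreal (indicator {0..} x * x powr (real (Suc k) + s - 1) / exp x) \<partial>lborel)"
    using AE_lborel_singleton[of 0]
  proof (intro nn_integral_cong_AE, eventually_elim)
    fix x :: real assume "x \<noteq> 0"
    show "ennreal (erlang_density k 1 x) * ennreal (x powr s) =
        ennreal (1 / fact k) * ennreal (indicator {0..} x * x powr (real (Suc k) + s - 1) / exp x)"
    proof (cases "0 < x")
      case True
      have "erlang_density k 1 x * x powr s = 1 / fact k * (indicator {0..} x * x powr (real (Suc k) + s - 1) / exp x)"
        using True by (simp add: erlang_density_def powr_add powr_realpow exp_minus field_simps)
      then show ?thesis by (simp flip: ennreal_mult' ennreal_mult'')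
    qed (use \<open>x \<noteq> 0\<close> in \<open>simp add: erlang_density_def\<close>)
  qed
  also have "\<dots> = ennreal (1 / fact k) * ennreal (Gamma (real (Suc k) + s))"
    using assms by (subst nn_integral_cmult) (auto simp: Gamma_conv_nn_integral_real)
  also have "\<dots> = ennreal (Gamma (real (Suc k) + s) / fact k)"
    by (simp flip: ennreal_mult')
  finally have nn: "(\<integral>\<^sup>+x. ennreal (x powr s) \<partial>erlang1 k) = ennreal (Gamma (real (Suc k) + s) / fact k)" .
  show "integrable (erlang1 k) (\<lambda>x. x powr s)"
    by (rule integrableI_nonneg) (auto simp: nn)
  have "0 < Gamma (real (Suc k) + s)" using assms by (intro Gamma_real_pos) simp
  then show "(\<integral>x. x powr s \<partial>erlang1 k) = Gamma (real (Suc k) + s) / fact k"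
    by (subst integral_eq_nn_integral) (auto simp: nn)
qed

text \<open>From \<open>ln u \<le> u\<close> at \<open>u = y powr (1/8)\<close>, so that
  \<open>4096 = 8 ^ 4\<close>; arguments below 1 are inverted. The exponents \<open>1/2\<close> and
  \<open>-1/2\<close> exceed \<open>- Suc k\<close> for each \<open>k\<close>, so the bound is
  integrable against every \<open>erlang1 k\<close>.\<close>

lemma ln_power4_le:
  fixes x :: real
  assumes "0 < x"
  shows "(ln x) ^ 4 \<le> 4096 * (x powr (1/2) + x powr (- 1/2))"
proof -
  have *: "(ln y) ^ 4 \<le> 4096 * y powr (1/2)" if "1 \<le> y" for y :: real
  proof -
    have "ln (y powr (1/8)) \<le> y powr (1/8)"
      using ln_le_minus_one[of "y powr (1/8)"] that by simp
    then have "ln y \<le> 8 * y powr (1/8)" using that by (simp add: ln_powr)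
    then have "(ln y) ^ 4 \<le> (8 * y powr (1/8)) ^ 4"
      using that by (intro power_mono) auto
    also have "\<dots> = 4096 * (y powr (1/8)) ^ 4" by (simp add: power_mult_distrib)
    also have "(y powr (1/8)) ^ 4 = y powr (1/2)"
      using that by (simp flip: powr_realpow add: powr_powr)
    finally show ?thesis .
  qed
  show ?thesis
  proof (cases "1 \<le> x")
    case True
    then show ?thesis using *[OF True] by (simp add: add_increasing2)
  next
    case False
    then have "1 \<le> inverse x" using assms by (simp add: one_le_inverse)
    from *[OF this] have "(ln x) ^ 4 \<le> 4096 * x powr (- 1/2)"
      using assms by (simp add: ln_inverse inverse_powr powr_minus)
    then show ?thesis by (simp add: add_increasing)
  qed
qed

lemma integrable_erlang1_ln_power4: "integrable (erlang1 k) (\<lambda>x. (ln x) ^ 4)"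
proof (rule Bochner_Integration.integrable_bound)
  show "integrable (erlang1 k) (\<lambda>x. 4096 * (x powr (1/2) + x powr (- 1/2)))"
    by (intro integrable_mult_right Bochner_Integration.integrable_add integrable_erlang1_powr) auto
  show "AE x in erlang1 k. norm ((ln x) ^ 4) \<le> norm (4096 * (x powr (1/2) + x powr (- 1/2)))"
    using AE_erlang1_pos
  proof eventually_elim
    fix x :: real assume "0 < x"
    from ln_power4_le[OF this]
    show "norm ((ln x) ^ 4) \<le> norm (4096 * (x powr (1/2) + x powr (- 1/2)))" by simp
  qed
qed simp

lemma integrable_erlang1_ln: "integrable (erlang1 k) ln"
proof -
  interpret prob_space "erlang1 k" by (rule prob_space_erlang_density) simp
  have "integrable (erlang1 k) (\<lambda>x. (ln x)\<^sup>2)"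
    by (rule square_integrable_imp_integrable)
      (use integrable_erlang1_ln_power4 in \<open>auto simp flip: power_mult\<close>)
  then show ?thesis by (rule square_integrable_imp_integrable[rotated]) simp
qed

lemma integral_erlang1_ln: "(\<integral>x. ln x \<partial>erlang1 k) = Digamma (real (Suc k))"
proof -
  interpret prob_space "erlang1 k" by (rule prob_space_erlang_density) simp
  let ?L = "\<integral>x. ln x \<partial>erlang1 k"
  define q where "q h = (Gamma (real (Suc k) + h) / fact k - 1) / h" for h
  have G: "Gamma (real (Suc k)) = fact k" using Gamma_fact[of k, where 'a=real] by (simp add: add.commute)
  have int: "integrable (erlang1 k) (\<lambda>x. (x powr h - 1) / h)"
    and E: "(\<integral>x. (x powr h - 1) / h \<partial>erlang1 k) = q h" if "- 1 < h" for h
  proof -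
    have "- real (Suc k) < h" using that by simp
    note * = integrable_erlang1_powr[OF this] integral_erlang1_powr[OF this]
    show "integrable (erlang1 k) (\<lambda>x. (x powr h - 1) / h)" using * by simp
    show "(\<integral>x. (x powr h - 1) / h \<partial>erlang1 k) = q h"
      using * prob_space by (simp add: q_def)
  qed
  \<comment> \<open>\<open>(x powr h - 1) / h\<close> bounds \<open>ln x\<close> from above for \<open>h > 0\<close> and from below for \<open>h < 0\<close>; its mean is
    a difference quotient of the Gamma function.\<close>
  have key: "h * ln x \<le> x powr h - 1" if "0 < x" for h x :: real
    using ln_le_minus_one[of "x powr h"] that by (simp add: ln_powr)
  have up: "?L \<le> q h" if "0 < h" for h
  proof -
    have "?L \<le> (\<integral>x. (x powr h - 1) / h \<partial>erlang1 k)"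
      using that AE_erlang1_pos[of k] key
      by (intro integral_mono_AE integrable_erlang1_ln int) (auto elim!: eventually_mono simp: pos_le_divide_eq mult.commute)
    then show ?thesis using E that by simp
  qed
  have lo: "q h \<le> ?L" if "- 1 < h" "h < 0" for h
  proof -
    have "(\<integral>x. (x powr h - 1) / h \<partial>erlang1 k) \<le> ?L"
      using that AE_erlang1_pos[of k] key
      by (intro integral_mono_AE integrable_erlang1_ln int) (auto elim!: eventually_mono simp: neg_divide_le_eq mult.commute)
    then show ?thesis using E that by simp
  qed
  \<comment> \<open>Differentiability of the Gamma function supplies both one-sided limits of
    \<open>q\<close>, namely \<open>Gamma' / Gamma\<close> at \<open>Suc k\<close>. The squeeze then
    needs no exchange of derivative and integral.\<close>
  have "(Gamma has_field_derivative Gamma (real (Suc k)) * Digamma (real (Suc k))) (at (real (Suc k)))"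
    by (rule has_field_derivative_Gamma) (auto simp: nonpos_Ints_def)
  then have "((\<lambda>h. (Gamma (real (Suc k) + h) - Gamma (real (Suc k))) / h) \<longlongrightarrow> Gamma (real (Suc k)) * Digamma (real (Suc k))) (at 0)"
    by (simp add: DERIV_def)
  then have "((\<lambda>h. (Gamma (real (Suc k) + h) - fact k) / h / fact k) \<longlongrightarrow> fact k * Digamma (real (Suc k)) / fact k) (at 0)"
    unfolding G by (intro tendsto_divide tendsto_const) auto
  moreover have "(\<lambda>h. (Gamma (real (Suc k) + h) - fact k) / h / fact k) = q"
    by (auto simp: q_def fun_eq_iff diff_divide_distrib mult.commute)
  ultimately have lim: "(q \<longlongrightarrow> Digamma (real (Suc k))) (at 0)" by simp
  have "?L \<le> Digamma (real (Suc k))"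
  proof (rule tendsto_lowerbound)
    show "(q \<longlongrightarrow> Digamma (real (Suc k))) (at_right 0)" using lim by (simp add: filterlim_at_split)
    show "\<forall>\<^sub>F h in at_right 0. ?L \<le> q h" using up by (auto simp: eventually_at_right[of 0 1] intro!: exI[of _ 1])
  qed simp
  moreover have "Digamma (real (Suc k)) \<le> ?L"
  proof (rule tendsto_upperbound)
    show "(q \<longlongrightarrow> Digamma (real (Suc k))) (at_left 0)" using lim by (simp add: filterlim_at_split)
    show "\<forall>\<^sub>F h in at_left 0. q h \<le> ?L" using lo by (auto simp: eventually_at_left[of "-1" 0] intro!: exI[of _ "-1"])
  qed simp
  ultimately show ?thesis by simp
qed

section \<open>The joint law of the two smallest components\<close>

text \<open>On the support this is minus the logarithm of the GEV distribution function. Values off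
  the support are harmless, since every integral weights them with \<open>gev_g\<close>, which is 0
  there.\<close>

definition gev_w :: "real \<Rightarrow> real \<Rightarrow> real \<Rightarrow> real \<Rightarrow> real" where
  "gev_w \<mu> \<sigma> \<xi> y = (let z = (y - \<mu>) / \<sigma> in if \<xi> = 0 then exp (- z) else (1 + \<xi> * z) powr (-1/\<xi>))"

definition gev_supp :: "real \<Rightarrow> real \<Rightarrow> real \<Rightarrow> real set" where
  "gev_supp \<mu> \<sigma> \<xi> = {y. 0 < 1 + \<xi> * ((y - \<mu>) / \<sigma>)}"

text \<open>The function \<open>gev_g\<close> is minus the derivative of \<open>gev_w\<close>, and \<open>gev_q\<close> is the inverse of \<open>gev_w\<close> on the support.\<close>

definition gev_g :: "real \<Rightarrow> real \<Rightarrow> real \<Rightarrow> real \<Rightarrow> real" where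
  "gev_g \<mu> \<sigma> \<xi> y = (if y \<in> gev_supp \<mu> \<sigma> \<xi> then gev_w \<mu> \<sigma> \<xi> y powr (1 + \<xi>) / \<sigma> else 0)"

definition gev_q :: "real \<Rightarrow> real \<Rightarrow> real \<Rightarrow> real \<Rightarrow> real" where
  "gev_q \<mu> \<sigma> \<xi> t = (if \<xi> = 0 then \<mu> - \<sigma> * ln t else \<mu> + \<sigma> * ((t powr (-\<xi>) - 1) / \<xi>))"

lemma measurable_gev_w [measurable]: "gev_w \<mu> \<sigma> \<xi> \<in> borel_measurable borel"
  unfolding gev_w_def[abs_def] Let_def by measurable

lemma sets_gev_supp [measurable]: "gev_supp \<mu> \<sigma> \<xi> \<in> sets borel"
  unfolding gev_supp_def by measurable

lemma measurable_gev_g [measurable]: "gev_g \<mu> \<sigma> \<xi> \<in> borel_measurable borel"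
  unfolding gev_g_def[abs_def] by measurable

lemma gev_w_pos: "y \<in> gev_supp \<mu> \<sigma> \<xi> \<Longrightarrow> 0 < gev_w \<mu> \<sigma> \<xi> y"
  by (auto simp: gev_w_def gev_supp_def Let_def)

lemma gev_g_nonneg: "0 < \<sigma> \<Longrightarrow> 0 \<le> gev_g \<mu> \<sigma> \<xi> y"
  by (auto simp: gev_g_def)

section \<open>Inverse and monotonicity of \<open>gev_w\<close>, and substitution on the
  line\<close>

lemma gev_q:
  assumes "0 < \<sigma>" "0 < t"
  shows gev_q_in_supp: "gev_q \<mu> \<sigma> \<xi> t \<in> gev_supp \<mu> \<sigma> \<xi>"
    and gev_w_gev_q: "gev_w \<mu> \<sigma> \<xi> (gev_q \<mu> \<sigma> \<xi> t) = t"
  using assms by (auto simp: gev_q_def gev_supp_def gev_w_def Let_def powr_powr)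

text \<open>The sign of \<xi> acts twice: for \<open>\<xi> > 0\<close> the base increases in the
  argument and the exponent is negative, for \<open>\<xi> < 0\<close> the base decreases and the
  exponent is positive. Either way \<open>gev_w\<close> decreases.\<close>

lemma gev_w_less_iff:
  assumes "0 < \<sigma>" "x \<in> gev_supp \<mu> \<sigma> \<xi>" "y \<in> gev_supp \<mu> \<sigma> \<xi>"
  shows "gev_w \<mu> \<sigma> \<xi> x < gev_w \<mu> \<sigma> \<xi> y \<longleftrightarrow> y < x"
proof -
  define u v where "u = 1 + \<xi> * ((x - \<mu>) / \<sigma>)" and "v = 1 + \<xi> * ((y - \<mu>) / \<sigma>)"
  have uv: "0 < u" "0 < v" using assms by (auto simp: u_def v_def gev_supp_def)
  have d: "u - v = (\<xi> / \<sigma>) * (x - y)"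
    using assms(1) by (simp add: u_def v_def field_simps)
  consider "\<xi> = 0" | "0 < \<xi>" | "\<xi> < 0" by linarith
  then show ?thesis
  proof cases
    case 1 then show ?thesis using assms(1) by (simp add: gev_w_def Let_def divide_less_cancel)
  next
    case 2
    have "u powr (-1/\<xi>) < v powr (-1/\<xi>) \<longleftrightarrow> ln v < ln u"
      using uv 2 by (simp add: powr_def divide_less_cancel)
    also have "\<dots> \<longleftrightarrow> 0 < u - v" using uv by simp
    also have "\<dots> \<longleftrightarrow> y < x" unfolding d zero_less_mult_iff using divide_pos_pos[OF 2 assms(1)] by auto
    finally show ?thesis using 2 by (simp add: gev_w_def Let_def u_def v_def)
  next
    case 3
    have "u powr (-1/\<xi>) < v powr (-1/\<xi>) \<longleftrightarrow> ln u < ln v"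
      using uv 3 by (simp add: powr_def divide_less_cancel)
    also have "\<dots> \<longleftrightarrow> u - v < 0" using uv by simp
    also have "\<dots> \<longleftrightarrow> y < x" unfolding d mult_less_0_iff using divide_neg_pos[OF 3 assms(1)] by auto
    finally show ?thesis using 3 by (simp add: gev_w_def Let_def u_def v_def)
  qed
qed

lemma gev_q_gev_w:
  assumes "0 < \<sigma>" "y \<in> gev_supp \<mu> \<sigma> \<xi>"
  shows "gev_q \<mu> \<sigma> \<xi> (gev_w \<mu> \<sigma> \<xi> y) = y"
  using gev_w_less_iff[OF assms(1)] gev_q[OF assms(1) gev_w_pos[OF assms(2)]] assms(2)
  by (metis less_irrefl linorder_less_linear)

lemma DERIV_gev_q:
  assumes "0 < t"
  shows "(gev_q \<mu> \<sigma> \<xi> has_field_derivative - (\<sigma> * t powr (-\<xi> - 1))) (at t within A)"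
proof (cases "\<xi> = 0")
  case True
  show ?thesis unfolding gev_q_def[abs_def] using True assms
    by (auto intro!: derivative_eq_intros simp: powr_minus field_simps)
next
  case False
  show ?thesis unfolding gev_q_def[abs_def] using False assms
    by (auto intro!: derivative_eq_intros simp: field_simps)
qed

text \<open>The domain is the image of \<open>(0, a)\<close> under \<open>gev_q\<close>, whatever
  the shape of the support, and the Jacobian cancels the integrand: the exponents
  \<open>-\<xi> - 1\<close> and \<open>1 + \<xi>\<close> add up to 0.\<close>

lemma nn_integral_gev_g_less:
  assumes "0 < \<sigma>" "0 < a"
  shows "(\<integral>\<^sup>+y. ennreal (gev_g \<mu> \<sigma> \<xi> y) * indicator {y\<in>gev_supp \<mu> \<sigma> \<xi>. gev_w \<mu> \<sigma> \<xi> y < a} y \<partial>lborel) = ennreal a"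
proof -
  let ?S = "{0<..<a}" and ?q = "gev_q \<mu> \<sigma> \<xi>" and ?g = "gev_g \<mu> \<sigma> \<xi>"
  let ?q' = "\<lambda>t. - (\<sigma> * t powr (-\<xi> - 1))"
  have img: "?q ` ?S = {y\<in>gev_supp \<mu> \<sigma> \<xi>. gev_w \<mu> \<sigma> \<xi> y < a}"
  proof (intro equalityI subsetI)
    fix y assume "y \<in> {y\<in>gev_supp \<mu> \<sigma> \<xi>. gev_w \<mu> \<sigma> \<xi> y < a}"
    then show "y \<in> ?q ` ?S"
      using gev_q_gev_w[OF assms(1)] gev_w_pos
      by (intro image_eqI[where x="gev_w \<mu> \<sigma> \<xi> y"]) auto
  qed (use gev_q[OF assms(1)] in auto)
  have one: "\<bar>?q' t\<bar> * ?g (?q t) = 1" if "t \<in> ?S" for t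
  proof -
    have "t powr (-\<xi> - 1) * t powr (1 + \<xi>) = 1"
      using that by (simp flip: powr_add)
    then show ?thesis
      using that gev_q[OF assms(1)] assms(1) by (simp add: gev_g_def abs_mult)
  qed
  have "((\<lambda>t. 1::real) has_integral a) ?S"
    using assms has_integral_iff_emeasure_lborel[of ?S a] by simp
  then have "((\<lambda>t. \<bar>?q' t\<bar> * ?g (?q t)) has_integral a) ?S"
    using has_integral_cong[of ?S "\<lambda>t. \<bar>?q' t\<bar> * ?g (?q t)" "\<lambda>_. 1" a] one by simp
  then have "(\<lambda>t. \<bar>?q' t\<bar> * ?g (?q t)) absolutely_integrable_on ?S \<and>
      integral ?S (\<lambda>t. \<bar>?q' t\<bar> * ?g (?q t)) = a"
    using gev_g_nonneg[OF assms(1)]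
    by (auto intro!: nonnegative_absolutely_integrable_1 simp: integrable_on_def integral_unique)
  moreover have "inj_on ?q ?S"
    using gev_q[OF assms(1)] by (intro inj_on_inverseI[where g="gev_w \<mu> \<sigma> \<xi>"]) auto
  ultimately have "?g absolutely_integrable_on (?q ` ?S) \<and> integral (?q ` ?S) ?g = a"
    by (subst (asm) has_absolute_integral_change_of_variables_1') (auto intro!: DERIV_gev_q)
  then have "(?g has_integral a) (?q ` ?S)"
    using set_lebesgue_integral_eq_integral(1) by (metis integrable_integral)
  then show ?thesis
    unfolding img using gev_g_nonneg[OF assms(1)] by (intro nn_integral_has_integral_lebesgue') auto
qed

text \<open>The preceding integral determines the image measure on half-lines, hence everywhere. The
  sign of \<open>gev_w\<close> is flipped because the comparison uses the sets \<open>{x<..}\<close>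
  and needs finite values: these have infinite mass for Lebesgue measure on the positive half-line,
  but mass \<open>max 0 (- x)\<close> after reflection.\<close>

lemma nn_integral_gev_substitution:
  assumes "0 < \<sigma>" and [measurable]: "f \<in> borel_measurable borel"
  shows "(\<integral>\<^sup>+y. ennreal (gev_g \<mu> \<sigma> \<xi> y) * f (gev_w \<mu> \<sigma> \<xi> y) \<partial>lborel) = (\<integral>\<^sup>+t. f t * indicator {0<..} t \<partial>lborel)"
proof -
  let ?w = "gev_w \<mu> \<sigma> \<xi>" and ?g = "\<lambda>y. ennreal (gev_g \<mu> \<sigma> \<xi> y)"
  have L: "emeasure (distr (density lborel ?g) borel (\<lambda>y. - ?w y)) {x<..} = ennreal (- x)" for x
  proof -
    have "emeasure (distr (density lborel ?g) borel (\<lambda>y. - ?w y)) {x<..}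
        = (\<integral>\<^sup>+y. ?g y * indicator {y. ?w y < - x} y \<partial>lborel)"
    proof -
      have "(\<lambda>y. - ?w y) -` {x<..} = {y. ?w y < - x}" by auto
      then show ?thesis by (simp add: emeasure_distr emeasure_density)
    qed
    also have "\<dots> = (\<integral>\<^sup>+y. ?g y * indicator {y\<in>gev_supp \<mu> \<sigma> \<xi>. ?w y < - x} y \<partial>lborel)"
      by (auto simp: gev_g_def intro!: nn_integral_cong split: split_indicator)
    also have "\<dots> = ennreal (- x)"
    proof (cases "x < 0")
      case True then show ?thesis using nn_integral_gev_g_less[OF assms(1), of "- x"] by simp
    next
      case False
      then have "{y\<in>gev_supp \<mu> \<sigma> \<xi>. ?w y < - x} = {}"
        using gev_w_pos[of _ \<mu> \<sigma> \<xi>] by force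
      then show ?thesis using False by (simp add: ennreal_neg)
    qed
    finally show ?thesis .
  qed
  have R: "emeasure (density lborel (indicator {..<0})) {x<..} = ennreal (- x)" for x :: real
  proof -
    have "emeasure (density lborel (indicator {..<0})) {x<..} = (\<integral>\<^sup>+t. indicator {x<..<0} t \<partial>lborel)"
      by (subst emeasure_density)
        (auto simp del: nn_integral_indicator intro!: nn_integral_cong split: split_indicator)
    then show ?thesis by (cases "x \<le> 0") (auto simp: ennreal_neg)
  qed
  have eq: "distr (density lborel ?g) borel (\<lambda>y. - ?w y) = density lborel (indicator {..<0})"
    by (rule measure_eqI_lessThan) (auto simp: L R)
  have "(\<integral>\<^sup>+y. ?g y * f (?w y) \<partial>lborel) = (\<integral>\<^sup>+u. f (- u) \<partial>distr (density lborel ?g) borel (\<lambda>y. - ?w y))"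
    by (simp add: nn_integral_distr nn_integral_density)
  also have "\<dots> = (\<integral>\<^sup>+u. indicator {..<0} u * f (- u) \<partial>lborel)"
    unfolding eq by (simp add: nn_integral_density)
  also have "\<dots> = (\<integral>\<^sup>+t. f t * indicator {0<..} t \<partial>lborel)"
    by (subst nn_integral_real_affine[where c="-1" and t=0])
      (auto intro!: nn_integral_cong split: split_indicator)
  finally show ?thesis .
qed

section \<open>Successive integration over decreasing tuples\<close>

primrec chain_weight :: "(real \<Rightarrow> ennreal) \<Rightarrow> nat \<Rightarrow> (nat \<Rightarrow> real) \<Rightarrow> ennreal" where
  "chain_weight g 0 y = g (y 1)"
| "chain_weight g (Suc k) y = chain_weight g k y *
     (g (y (Suc (Suc k))) * (if y (Suc (Suc k)) < y (Suc k) then 1 else 0))"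

lemma measurable_chain_weight [measurable]:
  assumes [measurable]: "g \<in> borel_measurable borel"
  shows "Suc k \<le> n \<Longrightarrow> chain_weight g k \<in> borel_measurable (\<Pi>\<^sub>M i\<in>{1..n}. lborel)"
proof (induction k)
  case 0
  have [measurable]: "(\<lambda>y. y 1) \<in> borel_measurable (\<Pi>\<^sub>M i\<in>{1..n}. lborel :: real measure)"
    using 0 measurable_component_singleton[of 1 "{1..n}" "\<lambda>_. lborel :: real measure"] by simp
  show ?case unfolding chain_weight.simps(1)[abs_def] by measurable
next
  case (Suc k)
  have [measurable]: "(\<lambda>y. y (Suc k)) \<in> borel_measurable (\<Pi>\<^sub>M i\<in>{1..n}. lborel :: real measure)"
    "(\<lambda>y. y (Suc (Suc k))) \<in> borel_measurable (\<Pi>\<^sub>M i\<in>{1..n}. lborel :: real measure)"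
    using Suc.prems measurable_component_singleton[of _ "{1..n}" "\<lambda>_. lborel :: real measure"] by simp_all
  have [measurable]: "chain_weight g k \<in> borel_measurable (\<Pi>\<^sub>M i\<in>{1..n}. lborel)"
    using Suc by simp
  show ?case unfolding chain_weight.simps(2)[abs_def] by measurable
qed

text \<open>The reason for the recursive form of the weight: \<open>chain_weight g k\<close> reads
  only the components \<open>1\<close> to \<open>Suc k\<close>, so it leaves the integral over the
  next coordinate as a constant factor.\<close>

lemma chain_weight_upd: "Suc k < i \<Longrightarrow> chain_weight g k (y(i := u)) = chain_weight g k y"
  by (induction k) auto

lemma chain_weight_eq:
  "chain_weight g k y = (if \<forall>j\<in>{1..k}. y (Suc j) < y j then \<Prod>j=1..Suc k. g (y j) else 0)"
proof (induction k)
  case (Suc k)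
  have "(\<forall>j\<in>{1..Suc k}. y (Suc j) < y j) \<longleftrightarrow> (\<forall>j\<in>{1..k}. y (Suc j) < y j) \<and> y (Suc (Suc k)) < y (Suc k)"
    by (auto simp: atLeastAtMostSuc_conv)
  with Suc show ?case by (simp add: mult.assoc)
qed simp

text \<open>\<open>h k x\<close> stands for the total weight of \<open>k\<close> decreasing
  components above \<open>x\<close>. Test functions are carried along because integrating out the
  newest coordinate leaves a function of the previous one, which the induction has to accept. The
  recursion for \<open>h\<close> is required only where \<open>g\<close> does not vanish, that is,
  on the support in the application; elsewhere both integrands are 0.\<close>

lemma nn_integral_chain_weight:
  fixes g :: "real \<Rightarrow> ennreal" and h :: "nat \<Rightarrow> real \<Rightarrow> ennreal"
  assumes [measurable]: "g \<in> borel_measurable borel" "\<And>k. h k \<in> borel_measurable borel"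
    and h0: "\<And>x. h 0 x = 1"
    and hSuc: "\<And>k y. g y \<noteq> 0 \<Longrightarrow>
      (\<integral>\<^sup>+x. g x * h k x * (if y < x then 1 else 0) \<partial>lborel) = h (Suc k) y"
  shows nn_integral_chain_weight1: "\<And>H. H \<in> borel_measurable borel \<Longrightarrow>
      (\<integral>\<^sup>+y. chain_weight g k y * H (y (Suc k)) \<partial>(\<Pi>\<^sub>M i\<in>{1..Suc k}. lborel)) = (\<integral>\<^sup>+x. g x * h k x * H x \<partial>lborel)"
    and nn_integral_chain_weight2: "\<And>F. case_prod F \<in> borel_measurable (borel \<Otimes>\<^sub>M borel) \<Longrightarrow>
      (\<integral>\<^sup>+y. chain_weight g (Suc k) y * F (y (Suc k)) (y (Suc (Suc k))) \<partial>(\<Pi>\<^sub>M i\<in>{1..Suc (Suc k)}. lborel)) =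
      (\<integral>\<^sup>+x. g x * h k x * (\<integral>\<^sup>+y. g y * (if y < x then 1 else 0) * F x y \<partial>lborel) \<partial>lborel)"
proof -
  interpret product_sigma_finite "\<lambda>_::nat. lborel :: real measure" by standard
  \<comment> \<open>One insertion of a coordinate: the inner integral over it depends on the
    preceding component alone and so serves as the test function of the induction
    hypothesis.\<close>
  have step: "(\<integral>\<^sup>+y. chain_weight g (Suc k) y * F (y (Suc k)) (y (Suc (Suc k))) \<partial>(\<Pi>\<^sub>M i\<in>{1..Suc (Suc k)}. lborel)) =
      (\<integral>\<^sup>+x. g x * h k x * (\<integral>\<^sup>+y. g y * (if y < x then 1 else 0) * F x y \<partial>lborel) \<partial>lborel)"
    if IH: "\<And>H. H \<in> borel_measurable borel \<Longrightarrow>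
      (\<integral>\<^sup>+y. chain_weight g k y * H (y (Suc k)) \<partial>(\<Pi>\<^sub>M i\<in>{1..Suc k}. lborel)) = (\<integral>\<^sup>+x. g x * h k x * H x \<partial>lborel)"
      and F: "case_prod F \<in> borel_measurable (borel \<Otimes>\<^sub>M borel)" for k F
  proof -
    note [measurable] = F
    let ?n = "Suc (Suc k)"
    have [measurable]: "(\<lambda>y. y (Suc k)) \<in> borel_measurable (\<Pi>\<^sub>M i\<in>{1..?n}. lborel :: real measure)"
      "(\<lambda>y. y ?n) \<in> borel_measurable (\<Pi>\<^sub>M i\<in>{1..?n}. lborel :: real measure)"
      using measurable_component_singleton[of _ "{1..?n}" "\<lambda>_. lborel :: real measure"] by simp_all
    have [measurable]: "chain_weight g (Suc k) \<in> borel_measurable (\<Pi>\<^sub>M i\<in>{1..?n}. lborel)"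
      by (rule measurable_chain_weight) auto
    have m: "(\<lambda>y. chain_weight g (Suc k) y * F (y (Suc k)) (y ?n)) \<in> borel_measurable (\<Pi>\<^sub>M i\<in>{1..?n}. lborel)"
      by measurable
    have ins: "{1..?n} = insert ?n {1..Suc k}" by auto
    have "(\<integral>\<^sup>+y. chain_weight g (Suc k) y * F (y (Suc k)) (y ?n) \<partial>(\<Pi>\<^sub>M i\<in>{1..?n}. lborel)) =
      (\<integral>\<^sup>+x. \<integral>\<^sup>+u. chain_weight g (Suc k) (x(?n := u)) * F (x (Suc k)) u \<partial>lborel \<partial>(\<Pi>\<^sub>M i\<in>{1..Suc k}. lborel))"
      using m unfolding ins by (subst product_nn_integral_insert) auto
    also have "\<dots> = (\<integral>\<^sup>+x. chain_weight g k x * (\<integral>\<^sup>+u. g u * (if u < x (Suc k) then 1 else 0) * F (x (Suc k)) u \<partial>lborel) \<partial>(\<Pi>\<^sub>M i\<in>{1..Suc k}. lborel))"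
    proof (intro nn_integral_cong)
      fix x
      show "(\<integral>\<^sup>+u. chain_weight g (Suc k) (x(?n := u)) * F (x (Suc k)) u \<partial>lborel) =
        chain_weight g k x * (\<integral>\<^sup>+u. g u * (if u < x (Suc k) then 1 else 0) * F (x (Suc k)) u \<partial>lborel)"
        by (subst nn_integral_cmult[symmetric])
          (auto simp: chain_weight_upd mult.assoc simp del: fun_upd_apply intro!: nn_integral_cong, simp_all)
    qed
    also have "\<dots> = (\<integral>\<^sup>+x. g x * h k x * (\<integral>\<^sup>+y. g y * (if y < x then 1 else 0) * F x y \<partial>lborel) \<partial>lborel)"
      by (rule IH) measurable
    finally show ?thesis .
  qed
  show one: "(\<integral>\<^sup>+y. chain_weight g k y * H (y (Suc k)) \<partial>(\<Pi>\<^sub>M i\<in>{1..Suc k}. lborel)) = (\<integral>\<^sup>+x. g x * h k x * H x \<partial>lborel)"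
    if "H \<in> borel_measurable borel" for H k
    using that
  proof (induction k arbitrary: H)
    case 0
    note [measurable] = 0
    show ?case
      using product_nn_integral_singleton[of "\<lambda>x. g x * H x" 1] by (simp add: h0)
  next
    case (Suc k)
    note [measurable] = Suc.prems
    have "(\<integral>\<^sup>+y. chain_weight g (Suc k) y * H (y (Suc (Suc k))) \<partial>(\<Pi>\<^sub>M i\<in>{1..Suc (Suc k)}. lborel)) =
      (\<integral>\<^sup>+x. g x * h k x * (\<integral>\<^sup>+y. g y * (if y < x then 1 else 0) * H y \<partial>lborel) \<partial>lborel)"
      by (rule step[where F="\<lambda>_ y. H y", OF Suc.IH]) (simp_all add: case_prod_beta')
    also have "\<dots> = (\<integral>\<^sup>+x. \<integral>\<^sup>+y. g x * h k x * (g y * (if y < x then 1 else 0) * H y) \<partial>lborel \<partial>lborel)"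
      by (intro nn_integral_cong nn_integral_cmult[symmetric]) measurable
    \<comment> \<open>The order is exchanged so that the older coordinate \<open>x\<close> becomes
      the inner variable, whose integral \<open>hSuc\<close> evaluates.\<close>
    also have "\<dots> = (\<integral>\<^sup>+y. \<integral>\<^sup>+x. g x * h k x * (g y * (if y < x then 1 else 0) * H y) \<partial>lborel \<partial>lborel)"
      by (rule lborel_pair.Fubini') measurable
    also have "\<dots> = (\<integral>\<^sup>+y. (g y * H y) * (\<integral>\<^sup>+x. g x * h k x * (if y < x then 1 else 0) \<partial>lborel) \<partial>lborel)"
      by (intro nn_integral_cong) (subst nn_integral_cmult[symmetric], auto simp: ac_simps)
    also have "\<dots> = (\<integral>\<^sup>+y. g y * h (Suc k) y * H y \<partial>lborel)"
    proof (intro nn_integral_cong)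
      fix y
      show "(g y * H y) * (\<integral>\<^sup>+x. g x * h k x * (if y < x then 1 else 0) \<partial>lborel) = g y * h (Suc k) y * H y"
      proof (cases "g y = 0")
        case False
        show ?thesis unfolding hSuc[OF False] by (simp only: ac_simps)
      qed simp
    qed
    finally show ?case .
  qed
  show "(\<integral>\<^sup>+y. chain_weight g (Suc k) y * F (y (Suc k)) (y (Suc (Suc k))) \<partial>(\<Pi>\<^sub>M i\<in>{1..Suc (Suc k)}. lborel)) =
      (\<integral>\<^sup>+x. g x * h k x * (\<integral>\<^sup>+y. g y * (if y < x then 1 else 0) * F x y \<partial>lborel) \<partial>lborel)"
    if "case_prod F \<in> borel_measurable (borel \<Otimes>\<^sub>M borel)" for F
    by (rule step[OF one that])
qed

section \<open>The density in terms of \<open>gev_w\<close>, and the joint law of the last two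
  images\<close>

lemma gev_g_eq_exp:
  assumes "0 < \<sigma>" "x \<in> gev_supp \<mu> \<sigma> \<xi>"
  shows "gev_g \<mu> \<sigma> \<xi> x = (1 / \<sigma>) * exp (- (if \<xi> = 0 then (x - \<mu>) / \<sigma>
      else (1/\<xi> + 1) * ln (1 + \<xi> * ((x - \<mu>) / \<sigma>))))"
proof (cases "\<xi> = 0")
  case True then show ?thesis using assms by (simp add: gev_g_def gev_w_def gev_supp_def)
next
  case False
  have pos: "0 < 1 + \<xi> * ((x - \<mu>) / \<sigma>)" using assms by (simp add: gev_supp_def)
  \<comment> \<open>The exponents match since
    \<open>(-1/\<xi>) * (1 + \<xi>) = - (1/\<xi> + 1)\<close>; this is why a power of
    \<open>gev_w\<close> describes the derivative uniformly in \<xi>.\<close>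
  have "gev_w \<mu> \<sigma> \<xi> x powr (1 + \<xi>) = (1 + \<xi> * ((x - \<mu>) / \<sigma>)) powr (- (1/\<xi> + 1))"
    using False by (simp add: gev_w_def Let_def powr_powr field_simps)
  also have "\<dots> = exp (- ((1/\<xi> + 1) * ln (1 + \<xi> * ((x - \<mu>) / \<sigma>))))"
  proof -
    have "u powr (- c) = exp (- (c * ln u))" if "0 < u" for u c :: real
      using that by (simp add: powr_def)
    from this[OF pos] show ?thesis .
  qed
  finally show ?thesis using False assms by (simp add: gev_g_def)
qed

text \<open>The ordering condition goes into \<open>chain_weight\<close>, the support condition into
  the zeros of \<open>gev_g\<close>, and only the factor in the last component remains outside the
  product.\<close>

lemma gev_r_density_eq:
  assumes "0 < \<sigma>"
  shows "ennreal (gev_r_density (Suc k) \<mu> \<sigma> \<xi> y) =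
    chain_weight (\<lambda>x. ennreal (gev_g \<mu> \<sigma> \<xi> x)) k y * ennreal (exp (- gev_w \<mu> \<sigma> \<xi> (y (Suc k))))"
proof -
  \<comment> \<open>\<open>l\<close> merges the cases \<open>\<xi> = 0\<close> and
    \<open>\<xi> \<noteq> 0\<close>, so that one computation with exponentials serves both.\<close>
  define l where "l x = (if \<xi> = 0 then (x - \<mu>) / \<sigma> else (1/\<xi> + 1) * ln (1 + \<xi> * ((x - \<mu>) / \<sigma>)))" for x
  let ?dec = "\<forall>j\<in>{1..k}. y (Suc j) < y j" and ?sup = "\<forall>j\<in>{1..Suc k}. y j \<in> gev_supp \<mu> \<sigma> \<xi>"
  have iv: "{1..<Suc k} = {1..k}" by auto
  have sp: "\<sigma> powr (- real (Suc k)) = (1 / \<sigma>) ^ Suc k"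
    unfolding powr_minus powr_realpow[OF assms] by (simp add: power_one_over inverse_eq_divide)
  have dens: "gev_r_density (Suc k) \<mu> \<sigma> \<xi> y = (if ?dec \<and> ?sup
      then (1 / \<sigma>) ^ Suc k * exp (- (\<Sum>j=1..Suc k. l (y j))) * exp (- gev_w \<mu> \<sigma> \<xi> (y (Suc k))) else 0)"
    unfolding gev_r_density_def Let_def iv sp gev_supp_def mem_Collect_eq
    by (simp only: l_def gev_w_def Let_def sum_distrib_left mult.assoc flip: exp_add)
      (simp del: sum.cl_ivl_Suc add: algebra_simps)
  show ?thesis
  proof (cases "?dec \<and> ?sup")
    case True
    have "(\<Prod>j=1..Suc k. ennreal (gev_g \<mu> \<sigma> \<xi> (y j))) = ennreal (\<Prod>j=1..Suc k. gev_g \<mu> \<sigma> \<xi> (y j))"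
      using gev_g_nonneg[OF assms] by (intro prod_ennreal) auto
    also have "(\<Prod>j=1..Suc k. gev_g \<mu> \<sigma> \<xi> (y j)) = (\<Prod>j=1..Suc k. (1 / \<sigma>) * exp (- l (y j)))"
      using True assms by (intro prod.cong) (auto simp: gev_g_eq_exp l_def)
    also have "\<dots> = (1 / \<sigma>) ^ Suc k * exp (- (\<Sum>j=1..Suc k. l (y j)))"
      unfolding prod.distrib sum_negf[symmetric] by (simp only: exp_sum finite_atLeastAtMost prod_constant) simp
    finally have prod: "(\<Prod>j=1..Suc k. ennreal (gev_g \<mu> \<sigma> \<xi> (y j)))
      = ennreal ((1 / \<sigma>) ^ Suc k * exp (- (\<Sum>j=1..Suc k. l (y j))))" .
    show ?thesis
      unfolding dens chain_weight_eq if_P[OF True] if_P[OF conjunct1[OF True]] prod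
      by (rule ennreal_mult'') simp
  next
    case False
    have "chain_weight (\<lambda>x. ennreal (gev_g \<mu> \<sigma> \<xi> x)) k y = 0"
    proof (cases ?dec)
      case True
      with False obtain j where "j \<in> {1..Suc k}" "y j \<notin> gev_supp \<mu> \<sigma> \<xi>" by blast
      then have "(\<Prod>j=1..Suc k. ennreal (gev_g \<mu> \<sigma> \<xi> (y j))) = 0"
        by (intro prod_zero) (auto simp: gev_g_def)
      then show ?thesis unfolding chain_weight_eq by simp
    next
      case nodec: False
      show ?thesis unfolding chain_weight_eq if_not_P[OF nodec] ..
    qed
    with False show ?thesis unfolding dens by (simp only: if_False) simp
  qed
qed

lemma nn_integral_power_Icc:
  "0 \<le> b \<Longrightarrow> (\<integral>\<^sup>+t. ennreal (t ^ k / fact k) * indicator {0..b} t \<partial>lborel) = ennreal (b ^ Suc k / fact (Suc k))"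
proof (subst nn_integral_FTC_Icc[where F="\<lambda>t. t ^ Suc k / fact (Suc k)"])
  fix t :: real
  have "((\<lambda>t. t ^ Suc k / fact (Suc k)) has_real_derivative (real (Suc k) * t ^ k) / fact (Suc k)) (at t)"
    by (auto intro!: derivative_eq_intros simp del: fact_Suc power_Suc)
  also have "(real (Suc k) * t ^ k) / fact (Suc k) = t ^ k / fact k"
    unfolding fact_Suc of_nat_mult by (rule mult_divide_mult_cancel_left) simp
  finally show "((\<lambda>t. t ^ Suc k / fact (Suc k)) has_real_derivative t ^ k / fact k) (at t)" .
qed (auto simp del: fact_Suc)

text \<open>In the variable \<open>t = gev_w x\<close> this integrates \<open>t^k / k!\<close> from
  0 to \<open>gev_w y\<close>, the volume recursion of ordered simplices. It is the hypothesis
  \<open>hSuc\<close> for \<open>h k x = gev_w x ^ k / fact k\<close>.\<close>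

lemma nn_integral_gev_g_power:
  assumes "0 < \<sigma>" "y \<in> gev_supp \<mu> \<sigma> \<xi>"
  shows "(\<integral>\<^sup>+x. ennreal (gev_g \<mu> \<sigma> \<xi> x) * ennreal (gev_w \<mu> \<sigma> \<xi> x ^ k / fact k) * (if y < x then 1 else 0) \<partial>lborel)
    = ennreal (gev_w \<mu> \<sigma> \<xi> y ^ Suc k / fact (Suc k))"
proof -
  let ?w = "gev_w \<mu> \<sigma> \<xi>" and ?g = "\<lambda>x. ennreal (gev_g \<mu> \<sigma> \<xi> x)"
  define b where "b = ?w y"
  have "0 < b" using gev_w_pos assms by (simp add: b_def)
  have "(\<integral>\<^sup>+x. ?g x * ennreal (?w x ^ k / fact k) * (if y < x then 1 else 0) \<partial>lborel)
    = (\<integral>\<^sup>+x. ?g x * (ennreal (?w x ^ k / fact k) * (if ?w x < b then 1 else 0)) \<partial>lborel)"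
  proof (intro nn_integral_cong)
    fix x show "?g x * ennreal (?w x ^ k / fact k) * (if y < x then 1 else 0)
      = ?g x * (ennreal (?w x ^ k / fact k) * (if ?w x < b then 1 else 0))"
      using gev_w_less_iff[OF assms(1) _ assms(2)]
      by (cases "x \<in> gev_supp \<mu> \<sigma> \<xi>") (auto simp: b_def gev_g_def)
  qed
  also have "\<dots> = (\<integral>\<^sup>+t. ennreal (t ^ k / fact k) * (if t < b then 1 else 0) * indicator {0<..} t \<partial>lborel)"
    by (rule nn_integral_gev_substitution[OF assms(1), of "\<lambda>t. ennreal (t ^ k / fact k) * (if t < b then 1 else 0)"]) measurable
  also have "\<dots> = (\<integral>\<^sup>+t. ennreal (t ^ k / fact k) * indicator {0..b} t \<partial>lborel)"
    using AE_lborel_singleton[of 0] AE_lborel_singleton[of b]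
    by (intro nn_integral_cong_AE) (auto split: split_indicator)
  also have "\<dots> = ennreal (b ^ Suc k / fact (Suc k))"
    using \<open>0 < b\<close> by (intro nn_integral_power_Icc) simp
  finally show ?thesis by (simp add: b_def)
qed

text \<open>With \<open>r = k + 2\<close>, the pair of images has density
  \<open>a^k / k! * exp (- t)\<close> on \<open>0 < a < t\<close>. A general test function
  \<open>F\<close> lets the same formula give the marginals and the probability of a curve.\<close>

lemma nn_integral_gev_law:
  assumes "0 < \<sigma>" and F: "case_prod F \<in> borel_measurable (borel \<Otimes>\<^sub>M borel)"
  shows "(\<integral>\<^sup>+y. F (gev_w \<mu> \<sigma> \<xi> (y (Suc k))) (gev_w \<mu> \<sigma> \<xi> (y (Suc (Suc k)))) \<partial>gev_r_distribution (Suc (Suc k)) \<mu> \<sigma> \<xi>)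
    = (\<integral>\<^sup>+a. ennreal (a ^ k / fact k) * (\<integral>\<^sup>+t. (if a < t then ennreal (exp (- t)) else 0) * F a t \<partial>lborel) * indicator {0<..} a \<partial>lborel)"
proof -
  note [measurable] = F
  let ?n = "Suc (Suc k)" and ?w = "gev_w \<mu> \<sigma> \<xi>"
  define g where "g x = ennreal (gev_g \<mu> \<sigma> \<xi> x)" for x
  have [measurable]: "g \<in> borel_measurable borel" by (simp add: g_def[abs_def])
  have [measurable]: "(\<lambda>y. y (Suc k)) \<in> borel_measurable (\<Pi>\<^sub>M i\<in>{1..?n}. lborel :: real measure)"
    "(\<lambda>y. y ?n) \<in> borel_measurable (\<Pi>\<^sub>M i\<in>{1..?n}. lborel :: real measure)"
    using measurable_component_singleton[of _ "{1..?n}" "\<lambda>_. lborel :: real measure"] by simp_all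
  have [measurable]: "chain_weight g (Suc k) \<in> borel_measurable (\<Pi>\<^sub>M i\<in>{1..?n}. lborel)"
    by (rule measurable_chain_weight) auto
  define F' where "F' x y = ennreal (exp (- ?w y)) * F (?w x) (?w y)" for x y
  have F' [measurable]: "case_prod F' \<in> borel_measurable (borel \<Otimes>\<^sub>M borel)"
    unfolding F'_def[abs_def] by measurable
  have "(\<integral>\<^sup>+y. F (?w (y (Suc k))) (?w (y ?n)) \<partial>gev_r_distribution ?n \<mu> \<sigma> \<xi>)
    = (\<integral>\<^sup>+y. chain_weight g (Suc k) y * ennreal (exp (- ?w (y ?n))) * F (?w (y (Suc k))) (?w (y ?n)) \<partial>(\<Pi>\<^sub>M i\<in>{1..?n}. lborel))"
    unfolding gev_r_distribution_def gev_space_def gev_r_density_eq[OF assms(1)] g_def[abs_def, symmetric]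
    by (rule nn_integral_density) measurable
  also have "\<dots> = (\<integral>\<^sup>+y. chain_weight g (Suc k) y * F' (y (Suc k)) (y ?n) \<partial>(\<Pi>\<^sub>M i\<in>{1..?n}. lborel))"
    by (simp add: F'_def mult.assoc)
  also have "\<dots> = (\<integral>\<^sup>+x. g x * ennreal (?w x ^ k / fact k) * (\<integral>\<^sup>+y. g y * (if y < x then 1 else 0) * F' x y \<partial>lborel) \<partial>lborel)"
  proof (rule nn_integral_chain_weight2[where h="\<lambda>k x. ennreal (?w x ^ k / fact k)"])
    show "(\<integral>\<^sup>+x. g x * ennreal (?w x ^ k / fact k) * (if y < x then 1 else 0) \<partial>lborel) = ennreal (?w y ^ Suc k / fact (Suc k))"
      if "g y \<noteq> 0" for k y
    proof -
      have "y \<in> gev_supp \<mu> \<sigma> \<xi>" using that by (auto simp: g_def gev_g_def split: if_splits)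
      from nn_integral_gev_g_power[OF assms(1) this] show ?thesis by (simp add: g_def)
    qed
  qed (use F' in auto)
  also have "\<dots> = (\<integral>\<^sup>+x. g x * (ennreal (?w x ^ k / fact k) *
      (\<integral>\<^sup>+t. (if ?w x < t then ennreal (exp (- t)) else 0) * F (?w x) t * indicator {0<..} t \<partial>lborel)) \<partial>lborel)"
  proof (intro nn_integral_cong)
    fix x
    show "g x * ennreal (?w x ^ k / fact k) * (\<integral>\<^sup>+y. g y * (if y < x then 1 else 0) * F' x y \<partial>lborel) =
      g x * (ennreal (?w x ^ k / fact k) *
      (\<integral>\<^sup>+t. (if ?w x < t then ennreal (exp (- t)) else 0) * F (?w x) t * indicator {0<..} t \<partial>lborel))"
    \<comment> \<open>On the support the order \<open>y < x\<close> of the components becomes the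
      reversed order of their images; off it the factor \<open>g x\<close> is 0.\<close>
    proof (cases "x \<in> gev_supp \<mu> \<sigma> \<xi>")
      case True
      have "(\<integral>\<^sup>+y. g y * (if y < x then 1 else 0) * F' x y \<partial>lborel)
        = (\<integral>\<^sup>+y. ennreal (gev_g \<mu> \<sigma> \<xi> y) * ((if ?w x < ?w y then ennreal (exp (- ?w y)) else 0) * F (?w x) (?w y)) \<partial>lborel)"
      proof (intro nn_integral_cong)
        fix y show "g y * (if y < x then 1 else 0) * F' x y =
          ennreal (gev_g \<mu> \<sigma> \<xi> y) * ((if ?w x < ?w y then ennreal (exp (- ?w y)) else 0) * F (?w x) (?w y))"
          using gev_w_less_iff[OF assms(1) True, of y]
          by (cases "y \<in> gev_supp \<mu> \<sigma> \<xi>") (auto simp: g_def F'_def gev_g_def)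
      qed
      also have "\<dots> = (\<integral>\<^sup>+t. (if ?w x < t then ennreal (exp (- t)) else 0) * F (?w x) t * indicator {0<..} t \<partial>lborel)"
        by (rule nn_integral_gev_substitution[OF assms(1), of "\<lambda>t. (if ?w x < t then ennreal (exp (- t)) else 0) * F (?w x) t"]) measurable
      finally show ?thesis by (simp only: mult.assoc)
    qed (simp add: g_def gev_g_def)
  qed
  also have "\<dots> = (\<integral>\<^sup>+a. ennreal (a ^ k / fact k) *
      (\<integral>\<^sup>+t. (if a < t then ennreal (exp (- t)) else 0) * F a t * indicator {0<..} t \<partial>lborel) * indicator {0<..} a \<partial>lborel)"
    unfolding g_def
    by (rule nn_integral_gev_substitution[OF assms(1), of "\<lambda>a. ennreal (a ^ k / fact k) *
      (\<integral>\<^sup>+t. (if a < t then ennreal (exp (- t)) else 0) * F a t * indicator {0<..} t \<partial>lborel)"]) measurable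
  also have "\<dots> = (\<integral>\<^sup>+a. ennreal (a ^ k / fact k) * (\<integral>\<^sup>+t. (if a < t then ennreal (exp (- t)) else 0) * F a t \<partial>lborel) * indicator {0<..} a \<partial>lborel)"
  proof (intro nn_integral_cong)
    fix a :: real
    have "(\<integral>\<^sup>+t. (if a < t then ennreal (exp (- t)) else 0) * F a t * indicator {0<..} t \<partial>lborel)
      = (\<integral>\<^sup>+t. (if a < t then ennreal (exp (- t)) else 0) * F a t \<partial>lborel)" if "0 < a"
      using that by (intro nn_integral_cong) (simp split: split_indicator)
    then show "ennreal (a ^ k / fact k) *
      (\<integral>\<^sup>+t. (if a < t then ennreal (exp (- t)) else 0) * F a t * indicator {0<..} t \<partial>lborel) * indicator {0<..} a
      = ennreal (a ^ k / fact k) * (\<integral>\<^sup>+t. (if a < t then ennreal (exp (- t)) else 0) * F a t \<partial>lborel) * indicator {0<..} a"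
      by (cases "0 < a") simp_all
  qed
  finally show ?thesis .
qed

section \<open>Erlang marginals\<close>

lemma nn_integral_exp_tail: "(\<integral>\<^sup>+t. (if a < t then ennreal (exp (- t)) else 0) \<partial>lborel) = ennreal (exp (- a))"
proof -
  have "(\<integral>\<^sup>+t. (if a < t then ennreal (exp (- t)) else 0) \<partial>lborel) = (\<integral>\<^sup>+t. ennreal (exp (- t)) * indicator {a..} t \<partial>lborel)"
    using AE_lborel_singleton[of a] by (intro nn_integral_cong_AE) (auto split: split_indicator)
  also have "\<dots> = ennreal (0 - (- exp (- a)))"
  proof (rule nn_integral_FTC_atLeast)
    show "((\<lambda>t. - exp (- t :: real)) \<longlongrightarrow> 0) at_top" by real_asymp
  qed (auto intro!: derivative_eq_intros)
  finally show ?thesis by simp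
qed

lemma sets_gev_r_distribution [measurable_cong]:
  "sets (gev_r_distribution r \<mu> \<sigma> \<xi>) = sets (gev_space r)"
  by (simp add: gev_r_distribution_def)

lemma measurable_gev_component:
  "j \<in> {1..r} \<Longrightarrow> (\<lambda>y. y j) \<in> borel_measurable (gev_space r)"
  using measurable_component_singleton[of j "{1..r}" "\<lambda>_. lborel :: real measure"]
  by (simp add: gev_space_def)

text \<open>Integrating out \<open>t\<close> over \<open>(a, \<infinity>)\<close> leaves
  \<open>exp (- a)\<close>, hence shape \<open>k + 1\<close>. Integrating out \<open>a\<close> over
  \<open>(0, t)\<close>, after Fubini, raises the power to \<open>t^(k+1) / (k+1)!\<close>, hence
  shape \<open>k + 2\<close>.\<close>

lemma
  fixes \<mu> \<sigma> \<xi> :: real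
  assumes "0 < \<sigma>"
  defines "P k \<equiv> gev_r_distribution (Suc (Suc k)) \<mu> \<sigma> \<xi>"
  shows distr_gev_w_penultimate: "distr (P k) borel (\<lambda>y. gev_w \<mu> \<sigma> \<xi> (y (Suc k))) = erlang1 k"
    and distr_gev_w_last: "distr (P k) borel (\<lambda>y. gev_w \<mu> \<sigma> \<xi> (y (Suc (Suc k)))) = erlang1 (Suc k)"
proof -
  have [measurable]: "(\<lambda>y. y (Suc k)) \<in> borel_measurable (P k)"
    "(\<lambda>y. y (Suc (Suc k))) \<in> borel_measurable (P k)"
    unfolding P_def measurable_cong_sets[OF sets_gev_r_distribution refl] by (auto intro!: measurable_gev_component)
  show "distr (P k) borel (\<lambda>y. gev_w \<mu> \<sigma> \<xi> (y (Suc k))) = erlang1 k"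
  proof (rule measure_eqI)
    fix A assume "A \<in> sets (distr (P k) borel (\<lambda>y. gev_w \<mu> \<sigma> \<xi> (y (Suc k))))"
    then have [measurable]: "A \<in> sets borel" by simp
    have "emeasure (distr (P k) borel (\<lambda>y. gev_w \<mu> \<sigma> \<xi> (y (Suc k)))) A
      = (\<integral>\<^sup>+x. indicator A x \<partial>distr (P k) borel (\<lambda>y. gev_w \<mu> \<sigma> \<xi> (y (Suc k))))"
      by simp
    also have "\<dots> = (\<integral>\<^sup>+y. indicator A (gev_w \<mu> \<sigma> \<xi> (y (Suc k))) \<partial>P k)"
      by (subst nn_integral_distr) auto
    also have "\<dots> = (\<integral>\<^sup>+a. ennreal (a ^ k / fact k) * (\<integral>\<^sup>+t. (if a < t then ennreal (exp (- t)) else 0) * indicator A a \<partial>lborel) * indicator {0<..} a \<partial>lborel)"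
      unfolding P_def by (rule nn_integral_gev_law[OF assms(1), where F="\<lambda>a t. indicator A a"]) measurable
    \<comment> \<open>The point 0 is discarded: for \<open>k = 0\<close> the Erlang density equals 1
      there, while the left side carries the indicator of the open half-line.\<close>
    also have "\<dots> = (\<integral>\<^sup>+a. ennreal (erlang_density k 1 a) * indicator A a \<partial>lborel)"
      using AE_lborel_singleton[of 0]
      by (intro nn_integral_cong_AE, eventually_elim)
        (auto simp: nn_integral_multc nn_integral_exp_tail erlang_density_def ennreal_mult'' divide_ennreal_def split: split_indicator simp flip: ennreal_mult'')
    also have "\<dots> = emeasure (erlang1 k) A" by (simp add: emeasure_density)
    finally show "emeasure (distr (P k) borel (\<lambda>y. gev_w \<mu> \<sigma> \<xi> (y (Suc k)))) A = emeasure (erlang1 k) A" .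
  qed simp
  show "distr (P k) borel (\<lambda>y. gev_w \<mu> \<sigma> \<xi> (y (Suc (Suc k)))) = erlang1 (Suc k)"
  proof (rule measure_eqI)
    fix A assume "A \<in> sets (distr (P k) borel (\<lambda>y. gev_w \<mu> \<sigma> \<xi> (y (Suc (Suc k)))))"
    then have [measurable]: "A \<in> sets borel" by simp
    have "emeasure (distr (P k) borel (\<lambda>y. gev_w \<mu> \<sigma> \<xi> (y (Suc (Suc k))))) A
      = (\<integral>\<^sup>+x. indicator A x \<partial>distr (P k) borel (\<lambda>y. gev_w \<mu> \<sigma> \<xi> (y (Suc (Suc k)))))"
      by simp
    also have "\<dots> = (\<integral>\<^sup>+y. indicator A (gev_w \<mu> \<sigma> \<xi> (y (Suc (Suc k)))) \<partial>P k)"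
      by (subst nn_integral_distr) auto
    also have "\<dots> = (\<integral>\<^sup>+a. ennreal (a ^ k / fact k) * (\<integral>\<^sup>+t. (if a < t then ennreal (exp (- t)) else 0) * indicator A t \<partial>lborel) * indicator {0<..} a \<partial>lborel)"
      unfolding P_def by (rule nn_integral_gev_law[OF assms(1), where F="\<lambda>a t. indicator A t"]) measurable
    also have "\<dots> = (\<integral>\<^sup>+a. (\<integral>\<^sup>+t. ennreal (a ^ k / fact k) * indicator {0<..} a * ((if a < t then ennreal (exp (- t)) else 0) * indicator A t) \<partial>lborel) \<partial>lborel)"
      by (subst nn_integral_cmult) (auto simp: ac_simps)
    also have "\<dots> = (\<integral>\<^sup>+t. (\<integral>\<^sup>+a. ennreal (a ^ k / fact k) * indicator {0<..} a * ((if a < t then ennreal (exp (- t)) else 0) * indicator A t) \<partial>lborel) \<partial>lborel)"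
      by (rule lborel_pair.Fubini') measurable
    also have "\<dots> = (\<integral>\<^sup>+t. ennreal (erlang_density (Suc k) 1 t) * indicator A t \<partial>lborel)"
    proof (intro nn_integral_cong)
      fix t :: real
      have "(\<integral>\<^sup>+a. ennreal (a ^ k / fact k) * indicator {0<..} a * ((if a < t then ennreal (exp (- t)) else 0) * indicator A t) \<partial>lborel)
        = (\<integral>\<^sup>+a. (ennreal (exp (- t)) * indicator A t) * (ennreal (a ^ k / fact k) * indicator {0..t} a) \<partial>lborel)"
        using AE_lborel_singleton[of 0] AE_lborel_singleton[of t]
        by (intro nn_integral_cong_AE, eventually_elim) (auto split: split_indicator simp: mult.commute)
      also have "\<dots> = (ennreal (exp (- t)) * indicator A t) * (\<integral>\<^sup>+a. ennreal (a ^ k / fact k) * indicator {0..t} a \<partial>lborel)"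
        by (rule nn_integral_cmult) simp
      also have "\<dots> = ennreal (erlang_density (Suc k) 1 t) * indicator A t"
      proof (cases "0 \<le> t")
        case True
        have "exp (- t) * (t ^ Suc k / fact (Suc k)) = erlang_density (Suc k) 1 t"
          using True by (simp add: erlang_density_def del: fact_Suc)
        then show ?thesis
          unfolding nn_integral_power_Icc[OF True]
          by (metis (no_types, lifting) ennreal_mult' exp_ge_zero mult.assoc mult.commute)
      qed (simp add: erlang_density_def)
      finally show "(\<integral>\<^sup>+a. ennreal (a ^ k / fact k) * indicator {0<..} a * ((if a < t then ennreal (exp (- t)) else 0) * indicator A t) \<partial>lborel)
        = ennreal (erlang_density (Suc k) 1 t) * indicator A t" .
    qed
    also have "\<dots> = emeasure (erlang1 (Suc k)) A" by (simp add: emeasure_density)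
    finally show "emeasure (distr (P k) borel (\<lambda>y. gev_w \<mu> \<sigma> \<xi> (y (Suc (Suc k))))) A = emeasure (erlang1 (Suc k)) A" .
  qed simp
qed

section \<open>The statistic D\<close>

lemma integrable_power4_add:
  fixes f g :: "'a \<Rightarrow> real"
  assumes [measurable]: "f \<in> borel_measurable M" "g \<in> borel_measurable M"
    and int: "integrable M (\<lambda>x. f x ^ 4)" "integrable M (\<lambda>x. g x ^ 4)"
  shows "integrable M (\<lambda>x. (f x + g x) ^ 4)"
proof (rule Bochner_Integration.integrable_bound)
  show "integrable M (\<lambda>x. 8 * f x ^ 4 + 8 * g x ^ 4)" using int by simp
  have p2: "(a + b)\<^sup>2 \<le> 2 * a\<^sup>2 + 2 * b\<^sup>2" for a b :: real
    using zero_le_power2[of "a - b"] by (simp add: power2_eq_square algebra_simps)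
  have "(a + b) ^ 4 \<le> 8 * a ^ 4 + 8 * b ^ 4" for a b :: real
  proof -
    have "(a + b) ^ 4 = ((a + b)\<^sup>2)\<^sup>2" by simp
    also have "\<dots> \<le> (2 * a\<^sup>2 + 2 * b\<^sup>2)\<^sup>2" by (intro power_mono p2) simp
    also have "\<dots> \<le> 2 * (2 * a\<^sup>2)\<^sup>2 + 2 * (2 * b\<^sup>2)\<^sup>2" by (rule p2)
    also have "\<dots> = 8 * a ^ 4 + 8 * b ^ 4" by (simp add: power_mult_distrib)
    finally show ?thesis .
  qed
  then show "AE x in M. norm ((f x + g x) ^ 4) \<le> norm (8 * f x ^ 4 + 8 * g x ^ 4)" by simp
qed simp

text \<open>With \<open>u\<close> the base of the power, \<open>(1 + \<xi>) * ln (u powr (-1/\<xi>))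
  = - ((1/\<xi> + 1) * ln u)\<close>. The support condition makes \<open>u\<close> positive, and the
  logarithm involves component \<open>r\<close> only.\<close>

lemma gev_D_eq:
  assumes "y r \<in> gev_supp \<mu> \<sigma> \<xi>"
  shows "gev_D r \<mu> \<sigma> \<xi> y = - ln \<sigma> - gev_w \<mu> \<sigma> \<xi> (y r) + gev_w \<mu> \<sigma> \<xi> (y (r - 1))
    + (1 + \<xi>) * ln (gev_w \<mu> \<sigma> \<xi> (y r))"
proof (cases "\<xi> = 0")
  case False
  define u where "u = 1 + \<xi> * ((y r - \<mu>) / \<sigma>)"
  have "0 < u" using assms by (simp add: u_def gev_supp_def)
  then have "(1 + \<xi>) * ln (u powr (-1/\<xi>)) = - ((1/\<xi> + 1) * ln u)"
    using False by (simp add: ln_powr field_simps)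
  then show ?thesis using False unfolding gev_D_def gev_w_def Let_def u_def by simp
qed (simp add: gev_D_def gev_w_def)

section \<open>Moments of \<open>D\<close> and absence of atoms\<close>

lemma measurable_gev_D:
  assumes "2 \<le> r"
  shows "gev_D r \<mu> \<sigma> \<xi> \<in> borel_measurable (gev_space r)"
proof -
  have [measurable]: "(\<lambda>y. y r) \<in> borel_measurable (gev_space r)"
    "(\<lambda>y. y (r - 1)) \<in> borel_measurable (gev_space r)"
    using assms by (auto intro!: measurable_gev_component)
  show ?thesis unfolding gev_D_def[abs_def] Let_def by measurable
qed

lemma AE_gev_supp:
  assumes "1 \<le> r" "0 < \<sigma>"
  shows "AE y in gev_r_distribution r \<mu> \<sigma> \<xi>. y r \<in> gev_supp \<mu> \<sigma> \<xi>"
proof -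
  obtain k where r: "r = Suc k" using assms(1) by (cases r) auto
  have m: "(\<lambda>y. ennreal (gev_r_density r \<mu> \<sigma> \<xi> y)) \<in> borel_measurable (gev_space r)"
    unfolding r gev_r_density_eq[OF assms(2)] gev_space_def
    using measurable_component_singleton[of "Suc k" "{1..Suc k}" "\<lambda>_. lborel :: real measure"]
    by (intro borel_measurable_times_ennreal measurable_chain_weight) auto
  show ?thesis
    unfolding gev_r_distribution_def AE_density[OF m]
    using assms by (auto simp: gev_r_density_def gev_supp_def Let_def split: if_splits)
qed

lemma
  fixes \<mu> \<sigma> \<xi> :: real
  assumes "2 \<le> r" "0 < \<sigma>"
  defines "P \<equiv> gev_r_distribution r \<mu> \<sigma> \<xi>"
  shows prob_space_gev_r_distribution: "prob_space P"
    and integrable_gev_D_power4: "integrable P (\<lambda>y. gev_D r \<mu> \<sigma> \<xi> y ^ 4)"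
    and integral_gev_D: "(\<integral>y. gev_D r \<mu> \<sigma> \<xi> y \<partial>P) = gev_eta r \<sigma> \<xi>"
    and emeasure_gev_D_eq: "emeasure P {y\<in>space P. gev_D r \<mu> \<sigma> \<xi> y = c} = 0"
proof -
  obtain k where r: "r = Suc (Suc k)"
    using assms(1) by (metis Suc_le_D numeral_2_eq_2 le_Suc_ex plus_nat.simps(2) plus_nat.simps(1))
  define a where "a y = gev_w \<mu> \<sigma> \<xi> (y (Suc k))" for y :: "nat \<Rightarrow> real"
  define b where "b y = gev_w \<mu> \<sigma> \<xi> (y r)" for y :: "nat \<Rightarrow> real"
  have [measurable]: "gev_D r \<mu> \<sigma> \<xi> \<in> borel_measurable P"
    using measurable_gev_D[OF assms(1)] by (simp add: P_def measurable_cong_sets[OF sets_gev_r_distribution refl])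
  have [measurable]: "a \<in> borel_measurable P" "b \<in> borel_measurable P"
    unfolding P_def measurable_cong_sets[OF sets_gev_r_distribution refl] a_def b_def
    by (auto intro!: measurable_compose[OF measurable_gev_component measurable_gev_w] simp: r)
  have da: "distr P borel a = erlang1 k" and db: "distr P borel b = erlang1 (Suc k)"
    using distr_gev_w_penultimate[OF assms(2)] distr_gev_w_last[OF assms(2)]
    by (simp_all add: P_def a_def[abs_def] b_def[abs_def] r)
  \<comment> \<open>The normalisation of the density comes for free: an image measure has the same
    total mass, and the image under \<open>a\<close> is an Erlang law.\<close>
  show prob: "prob_space P"
  proof (rule prob_space_distrD[of a P borel])
    show "prob_space (distr P borel a)"
      unfolding da by (rule prob_space_erlang_density) simp
  qed simp
  interpret prob_space P by fact
  have AE: "AE y in P. gev_D r \<mu> \<sigma> \<xi> y = (- ln \<sigma> + - b y) + (a y + (1 + \<xi>) * ln (b y))"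
    using AE_gev_supp[of r \<sigma> \<mu> \<xi>] assms unfolding P_def
    by (auto elim!: eventually_mono simp: gev_D_eq a_def b_def r)
  have pow: "integrable (erlang1 j) (\<lambda>x. x ^ n)" for j n
  proof (rule integrable_cong_AE_imp)
    show "integrable (erlang1 j) (\<lambda>x. x powr (real n))" by (rule integrable_erlang1_powr) simp
    show "AE x in erlang1 j. x powr real n = x ^ n"
      using AE_erlang1_pos by eventually_elim (simp add: powr_realpow)
  qed simp
  have mean: "(\<integral>x. x \<partial>erlang1 j) = real (Suc j)" for j
  proof -
    have "(\<integral>x. x \<partial>erlang1 j) = (\<integral>x. x powr 1 \<partial>erlang1 j)"
      by (rule integral_cong_AE) (use AE_erlang1_pos[of j] in \<open>auto elim!: eventually_mono\<close>)
    also have "\<dots> = Gamma (real (Suc j) + 1) / fact j" by (rule integral_erlang1_powr) simp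
    also have "\<dots> = real (Suc j)"
      using Gamma_fact[of "Suc j", where 'a=real] by (simp add: add_ac)
    finally show ?thesis .
  qed
  have "integrable P (\<lambda>y. f (a y)) \<longleftrightarrow> integrable (erlang1 k) f"
    "integrable P (\<lambda>y. f (b y)) \<longleftrightarrow> integrable (erlang1 (Suc k)) f"
    "(\<integral>y. f (a y) \<partial>P) = (\<integral>x. f x \<partial>erlang1 k)"
    "(\<integral>y. f (b y) \<partial>P) = (\<integral>x. f x \<partial>erlang1 (Suc k))"
    if "f \<in> borel_measurable borel" for f :: "real \<Rightarrow> real"
    unfolding da[symmetric] db[symmetric] using that
    by (simp_all add: integrable_distr_eq integral_distr)
  note tr = this
  have i4: "integrable P (\<lambda>y. a y ^ 4)" "integrable P (\<lambda>y. b y ^ 4)" "integrable P (\<lambda>y. ln (b y) ^ 4)"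
    using tr(1)[of "\<lambda>x. x ^ 4"] tr(2)[of "\<lambda>x. x ^ 4"] tr(2)[of "\<lambda>x. ln x ^ 4"] pow integrable_erlang1_ln_power4
    by simp_all
  have i1: "integrable P a" "integrable P b" "integrable P (\<lambda>y. ln (b y))"
    using tr(1)[of "\<lambda>x. x"] tr(2)[of "\<lambda>x. x"] tr(2)[of ln] pow[of _ 1] integrable_erlang1_ln by simp_all
  have e1: "expectation a = real (Suc k)" "expectation b = real (Suc (Suc k))"
      "expectation (\<lambda>y. ln (b y)) = Digamma (real r)"
    using tr(3)[of "\<lambda>x. x"] tr(4)[of "\<lambda>x. x"] tr(4)[of ln] mean integral_erlang1_ln[of "Suc k"] by (simp_all add: r)
  have "integrable P (\<lambda>y. ((- ln \<sigma> + - b y) + (a y + (1 + \<xi>) * ln (b y))) ^ 4)"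
    using i4 by (intro integrable_power4_add) (auto simp: power_mult_distrib)
  then show "integrable P (\<lambda>y. gev_D r \<mu> \<sigma> \<xi> y ^ 4)"
    by (rule integrable_cong_AE_imp) (use AE in \<open>auto elim!: eventually_mono\<close>)
  have "expectation (gev_D r \<mu> \<sigma> \<xi>) = expectation (\<lambda>y. (- ln \<sigma> + - b y) + (a y + (1 + \<xi>) * ln (b y)))"
    by (rule integral_cong_AE) (use AE in auto)
  \<comment> \<open>The means \<open>k + 1\<close> of \<open>a\<close> and \<open>k + 2\<close> of
    \<open>b\<close> differ by 1, which is the constant \<open>- 1\<close> in
    \<open>gev_eta\<close>.\<close>
  also have "\<dots> = gev_eta r \<sigma> \<xi>"
    using i1 e1 prob_space by (simp add: gev_eta_def)
  finally show "expectation (gev_D r \<mu> \<sigma> \<xi>) = gev_eta r \<sigma> \<xi>" .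
  \<comment> \<open>The equation \<open>D = c\<close> solved for \<open>a\<close> in terms of
    \<open>t = b\<close>. With \<open>t\<close> fixed, a single value of \<open>x\<close> satisfies
    it, so integrating over \<open>x\<close> first gives 0.\<close>
  define \<phi> where "\<phi> t = c + ln \<sigma> + t - (1 + \<xi>) * ln t" for t
  have [measurable]: "\<phi> \<in> borel_measurable borel" by (simp add: \<phi>_def[abs_def])
  have "emeasure P {y\<in>space P. gev_D r \<mu> \<sigma> \<xi> y = c} = emeasure P {y\<in>space P. a y = \<phi> (b y)}"
    by (rule emeasure_eq_AE) (use AE in \<open>auto elim!: eventually_mono simp: \<phi>_def\<close>)
  also have "\<dots> = (\<integral>\<^sup>+y. indicator {y\<in>space P. a y = \<phi> (b y)} y \<partial>P)" by simp
  also have "\<dots> = (\<integral>\<^sup>+y. (if a y = \<phi> (b y) then 1 else 0) \<partial>P)"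
    by (intro nn_integral_cong) (simp split: split_indicator)
  also have "\<dots> = (\<integral>\<^sup>+x. ennreal (x ^ k / fact k) * (\<integral>\<^sup>+t. (if x < t then ennreal (exp (- t)) else 0) * (if x = \<phi> t then 1 else 0) \<partial>lborel) * indicator {0<..} x \<partial>lborel)"
    unfolding P_def a_def b_def r
    by (rule nn_integral_gev_law[OF assms(2), where F="\<lambda>x t. if x = \<phi> t then 1 else 0"]) measurable
  also have "\<dots> = (\<integral>\<^sup>+x. (\<integral>\<^sup>+t. ennreal (x ^ k / fact k) * indicator {0<..} x * ((if x < t then ennreal (exp (- t)) else 0) * (if x = \<phi> t then 1 else 0)) \<partial>lborel) \<partial>lborel)"
    by (subst nn_integral_cmult) (auto simp: ac_simps)
  also have "\<dots> = (\<integral>\<^sup>+t. (\<integral>\<^sup>+x. ennreal (x ^ k / fact k) * indicator {0<..} x * ((if x < t then ennreal (exp (- t)) else 0) * (if x = \<phi> t then 1 else 0)) \<partial>lborel) \<partial>lborel)"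
    by (rule lborel_pair.Fubini') measurable
  also have "\<dots> = (\<integral>\<^sup>+t. (\<integral>\<^sup>+x. 0 \<partial>(lborel :: real measure)) \<partial>(lborel :: real measure))"
  proof (rule nn_integral_cong)
    fix t :: real
    show "(\<integral>\<^sup>+x. ennreal (x ^ k / fact k) * indicator {0<..} x * ((if x < t then ennreal (exp (- t)) else 0) * (if x = \<phi> t then 1 else 0)) \<partial>lborel)
      = (\<integral>\<^sup>+x. 0 \<partial>(lborel :: real measure))"
      by (intro nn_integral_cong_AE eventually_mono[OF AE_lborel_singleton[of "\<phi> t"]]) simp
  qed
  finally show "emeasure P {y\<in>space P. gev_D r \<mu> \<sigma> \<xi> y = c} = 0" by simp
qed

theorem theorem1:
  fixes M :: "'a measure" and Y :: "nat \<Rightarrow> 'a \<Rightarrow> (nat \<Rightarrow> real)"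
    and r :: nat and \<mu> \<sigma> \<xi> :: real
  assumes "prob_space M"
    and "r \<ge> 2" and "\<sigma> > 0"
    and "\<And>i. Y i \<in> measurable M (gev_space r)"
    and "prob_space.indep_vars M (\<lambda>_. gev_space r) Y UNIV"
    and "\<And>i. distr M (gev_space r) (Y i) = gev_r_distribution r \<mu> \<sigma> \<xi>"
  shows "weak_conv_m (\<lambda>n. distr M borel (\<lambda>\<omega>. gev_T r \<mu> \<sigma> \<xi> n (\<lambda>i. Y i \<omega>)))
           std_normal_distribution"
proof -
  interpret prob_space M by fact
  note [measurable] = assms(4)
  define P where "P = gev_r_distribution r \<mu> \<sigma> \<xi>"
  let ?D = "gev_D r \<mu> \<sigma> \<xi>" and ?m = "gev_eta r \<sigma> \<xi>"
  note [measurable] = measurable_gev_D[OF assms(2), of \<mu> \<sigma> \<xi>]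
  have [measurable]: "?D \<in> borel_measurable P"
    unfolding P_def measurable_cong_sets[OF sets_gev_r_distribution refl] by measurable
  interpret P: prob_space P
    unfolding P_def by (rule prob_space_gev_r_distribution[OF assms(2,3)])
  \<comment> \<open>\<open>gev_T\<close> runs over the blocks \<open>1..n\<close>, the limit theorem
    over \<open>i < n\<close>. The shift by \<open>Suc\<close> reconciles them, and
    \<open>indep_vars_reindex\<close> carries independence along.\<close>
  define X where "X i \<omega> = ?D (Y (Suc i) \<omega>)" for i \<omega>
  define v where "v = P.variance ?D"
  have PY: "distr M (gev_space r) (Y i) = P" for i using assms(6) by (simp add: P_def)
  have tr: "integrable M (\<lambda>\<omega>. f (Y i \<omega>)) \<longleftrightarrow> integrable P f" "expectation (\<lambda>\<omega>. f (Y i \<omega>)) = P.expectation f"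
    if "f \<in> borel_measurable (gev_space r)" for f :: "(nat \<Rightarrow> real) \<Rightarrow> real" and i
    unfolding PY[of i, symmetric] using that by (simp_all add: integrable_distr_eq integral_distr)
  have mean: "P.expectation ?D = ?m" unfolding P_def by (rule integral_gev_D[OF assms(2,3)])
  have i4: "integrable P (\<lambda>y. ?D y ^ 4)" unfolding P_def by (rule integrable_gev_D_power4[OF assms(2,3)])
  have i2: "integrable P (\<lambda>y. (?D y)\<^sup>2)"
    by (rule P.square_integrable_imp_integrable) (use i4 in \<open>auto simp flip: power_mult\<close>)
  have i1: "integrable P ?D"
    by (rule P.square_integrable_imp_integrable[OF _ i2]) simp
  \<comment> \<open>Zero variance would make \<open>D\<close> almost surely equal to its mean,
    giving that single level probability 1 instead of 0.\<close>
  have "v \<noteq> 0"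
  proof
    assume "v = 0"
    moreover have "integrable P (\<lambda>y. (?D y - ?m)\<^sup>2)"
      using i1 i2 by (simp add: power2_diff)
    ultimately have "AE y in P. (?D y - ?m)\<^sup>2 = 0"
      unfolding v_def mean by (subst (asm) integral_nonneg_eq_0_iff_AE) auto
    then have "AE y in P. y \<in> {y\<in>space P. ?D y = ?m}" by (auto elim!: AE_mp)
    then have "emeasure P {y\<in>space P. ?D y = ?m} = 1"
      by (intro P.emeasure_eq_1_AE) auto
    then show False using emeasure_gev_D_eq[OF assms(2,3), of \<mu> \<xi> ?m] by (simp add: P_def)
  qed
  then have "0 < v" using P.variance_positive[of ?D] by (simp add: v_def less_le)
  have "weak_conv_m (\<lambda>n. distr M borel (\<lambda>\<omega>. sqrt n * ((\<Sum>i<n. X i \<omega>) / n - ?m) /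
      sqrt ((\<Sum>i<n. (X i \<omega> - (\<Sum>i<n. X i \<omega>) / n)\<^sup>2) / (real n - 1)))) std_normal_distribution"
  proof (rule studentized_central_limit_theorem)
    have "indep_vars (\<lambda>_. gev_space r) (\<lambda>i. Y (Suc i)) UNIV"
      using indep_vars_reindex[OF inj_Suc assms(5)] by simp
    then show "indep_vars (\<lambda>_. borel) X UNIV"
      unfolding X_def[abs_def] by (rule indep_vars_compose2) simp
    show "distr M borel (X i) = distr P borel ?D" for i
      unfolding X_def[abs_def] PY[of "Suc i", symmetric] by (subst distr_distr) (auto simp: comp_def)
    show "integrable M (\<lambda>\<omega>. X i \<omega> ^ 4)" for i
      unfolding X_def using tr(1)[of "\<lambda>y. ?D y ^ 4"] i4 by simp
    show mX: "expectation (X i) = ?m" for i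
      unfolding X_def[abs_def] using tr(2)[of ?D] mean by simp
    show "variance (X i) = v" for i
      unfolding mX unfolding X_def using tr(2)[of "\<lambda>y. (?D y - ?m)\<^sup>2"] by (simp add: v_def mean)
  qed fact
  moreover have "gev_T r \<mu> \<sigma> \<xi> n (\<lambda>i. Y i \<omega>) = sqrt n * ((\<Sum>i<n. X i \<omega>) / n - ?m) /
      sqrt ((\<Sum>i<n. (X i \<omega> - (\<Sum>i<n. X i \<omega>) / n)\<^sup>2) / (real n - 1))" for n \<omega>
  proof -
    have "(\<Sum>i=1..n. f i) = (\<Sum>i<n. f (Suc i))" for f :: "nat \<Rightarrow> real"
      by (simp add: sum.atLeast1_atMost_eq)
    then show ?thesis unfolding gev_T_def Let_def X_def by simp
  qed
  ultimately show ?thesis by simp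
qed

end
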